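(* Consider the three-state Potts model on the Cayley tree $(V,E)$ of order $2$ with root $o$ and $\theta=e^\beta>4$. Let $(i,j,k)$ be a permutation of $(1,2,3)$, and let $l=l_-^{(i)}$ (an $f$-saddle) or $l=l_{\mathrm{free}}$. Then there exists a time $t_B<\infty$ such that for every $t\ge t_B$ there exists $\epsilon(t)>0$ with the following property: for every cofinal sequence $(\Lambda_n)_{n\in\mathbb N}$ of finite subsets of $V$ one can choose a sequence of finite sets $(\Delta_n)_{n\in\mathbb N}$ with $\Lambda_n\subset\Delta_n\Subset V$ for every $n$, such that $$\liminf_{n\to\infty}\left|\mu^l_t\left(\eta_o=j\mid\eta_{\Lambda_n\setminus\{o\}},j_{\Delta_n\setminus\Lambda_n}\right)-\mu^l_t\left(\eta_o=j\mid\eta_{\Lambda_n\setminus\{o\}},k_{\Delta_n\setminus\Lambda_n}\right)\right|\ge\epsilon(t)$$ for every $\eta\in\{1,2,3\}^V$.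
   Context: Tree: every vertex has exactly $3$ nearest neighbors ($d=2$); $o$ is a fixed root vertex; $\Lambda\Subset V$ means finite subset; $\partial\Lambda$ is the set of vertices of $\Lambda^c$ with a neighbor in $\Lambda$. Cofinal sequence: increasing sequence of finite subsets exhausting $V$. Spin space $S=\{1,2,3\}$, $\Omega=S^V$; $\sigma_\Lambda$ denotes the projection to $S^\Lambda$. Potts model: $Q(a,b)=\exp(\beta\delta_{ab})$, $\beta>0$, $\theta=e^\beta$. $\Delta^2$ is the simplex of probability vectors in $\mathbb R^3$. The homogeneous boundary-law recursion is $f:\Delta^2\to\Delta^2$, $f_a(p)=\frac{(1+(\theta-1)p_a)^2}{\sum_{b=1}^3(1+(\theta-1)p_b)^2}$. Set $x_-=\left(\frac{\theta-1-\sqrt{(\theta-1)^2-8}}{2}\right)^2$ and $l_-^{(i)}(a)=\frac{1+(x_--1)\delta_{ia}}{x_-+2}$, $a\in\{1,2,3\}$; $l_{\mathrm{free}}=(\frac13,\frac13,\frac13)$. These are fixed points of $f$. For a fixed point $l$ of $f$, $\mu^l$ is the probability measure on $\Omega$ with, for finite connected $\Lambda$, $$\mu^l(\sigma_{\Lambda\cup\partial\Lambda}=\omega_{\Lambda\cup\partial\Lambda})=\frac1{Z_\Lambda}\prod_{\{x,y\}\in E,\ \{x,y\}\cap\Lambda\neq\emptyset}Q(\omega_x,\omega_y)\prod_{z\in\partial\Lambda}l(\omega_z).$$ The time-evolved measure is $\mu^l_t=\mu^l\pi_t$, $\pi_t(\sigma,d\eta)=\bigotimes_{x\in V}P_t(\sigma_x,d\eta_x)$,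 with $P_t(a,b)=\frac13+(\delta_{ab}-\frac13)e^{-\frac32t}$. The expression $\mu^l_t(\eta_o=j\mid\eta_{\Lambda_n\setminus\{o\}},a_{\Delta_n\setminus\Lambda_n})$ denotes the conditional probability under $\mu^l_t$ that the spin at $o$ equals $j$, given that the spins on $\Lambda_n\setminus\{o\}$ equal those of $\eta$ and all spins on $\Delta_n\setminus\Lambda_n$ equal $a$. *)

theory Defs
  imports "HOL-Probability.Probability"
begin

section \<open>The Cayley tree of order 2\<close>

text \<open>The vertex set is the whole type \<open>'v\<close>; a graph is given by its set \<open>E\<close> of
  undirected edges.\<close>

definition connected_in :: "'v set set \<Rightarrow> 'v set \<Rightarrow> bool" where
  "connected_in E L \<longleftrightarrow>
     (\<forall>x\<in>L. \<forall>y\<in>L. (\<lambda>u v. u \<in> L \<and> v \<in> L \<and> {u, v} \<in> E)\<^sup>*\<^sup>* x y)"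

definition acyclic_edges :: "'v set set \<Rightarrow> bool" where
  "acyclic_edges E \<longleftrightarrow>
     \<not> (\<exists>xs. 3 \<le> length xs \<and> distinct xs \<and> successively (\<lambda>u v. {u, v} \<in> E) xs
           \<and> {last xs, hd xs} \<in> E)"

definition cayley_tree :: "'v set set \<Rightarrow> bool" where
  "cayley_tree E \<longleftrightarrow>
     (\<forall>e\<in>E. card e = 2) \<and> connected_in E UNIV \<and> acyclic_edges E
     \<and> (\<forall>x. card {y. {x, y} \<in> E} = 3)"

definition outer_boundary :: "'v set set \<Rightarrow> 'v set \<Rightarrow> 'v set" where
  "outer_boundary E L = {y. y \<notin> L \<and> (\<exists>x\<in>L. {x, y} \<in> E)}"

definition cofinal_seq :: "(nat \<Rightarrow> 'v set) \<Rightarrow> bool" where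
  "cofinal_seq L \<longleftrightarrow> incseq L \<and> (\<forall>n. finite (L n)) \<and> (\<Union>n. L n) = UNIV"


section \<open>The Potts model and its boundary laws\<close>

text \<open>The spin space \<open>{1,2,3}\<close> is the three-element type \<open>3\<close> (in which the
  numeral \<open>3\<close> denotes the third element, equal to \<open>0\<close>), so that probability vectors on
  spins live in \<open>real^3\<close>.\<close>

definition potts_Q :: "real \<Rightarrow> 3 \<Rightarrow> 3 \<Rightarrow> real" where
  "potts_Q \<beta> a b = exp (\<beta> * of_bool (a = b))"

text \<open>The value of \<open>Q\<close> on an undirected edge; it is well defined because \<open>Q\<close> is symmetric,
  see \<open>edge_weight_pair\<close>.\<close>

definition edge_weight :: "real \<Rightarrow> ('v \<Rightarrow> 3) \<Rightarrow> 'v set \<Rightarrow> real" where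
  "edge_weight \<beta> \<omega> e = (THE q. \<exists>x y. e = {x, y} \<and> q = potts_Q \<beta> (\<omega> x) (\<omega> y))"

lemma edge_weight_pair: "edge_weight \<beta> \<omega> {x, y} = potts_Q \<beta> (\<omega> x) (\<omega> y)"
proof -
  have sym: "potts_Q \<beta> a b = potts_Q \<beta> b a" for a b
    by (cases "a = b") (simp_all add: potts_Q_def)
  show ?thesis
    unfolding edge_weight_def
    by (rule the_equality, blast) (use sym in \<open>fastforce simp only: doubleton_eq_iff\<close>)
qed

definition boundary_map :: "real \<Rightarrow> real^3 \<Rightarrow> real^3" where
  "boundary_map \<theta> p =
     (\<chi> a. (1 + (\<theta> - 1) * p $ a)\<^sup>2 / (\<Sum>b\<in>UNIV. (1 + (\<theta> - 1) * p $ b)\<^sup>2))"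

definition simplex2 :: "(real^3) set" where
  "simplex2 = {p. (\<forall>a. 0 \<le> p $ a) \<and> (\<Sum>a\<in>UNIV. p $ a) = 1}"

definition x_minus :: "real \<Rightarrow> real" where
  "x_minus \<theta> = ((\<theta> - 1 - sqrt ((\<theta> - 1)\<^sup>2 - 8)) / 2)\<^sup>2"

definition l_minus :: "real \<Rightarrow> 3 \<Rightarrow> real^3" where
  "l_minus \<theta> i = (\<chi> a. (1 + (x_minus \<theta> - 1) * of_bool (i = a)) / (x_minus \<theta> + 2))"

definition l_free :: "real^3" where
  "l_free = (\<chi> a. 1 / 3)"

lemma l_free_fixed: "\<theta> > 1 \<Longrightarrow> l_free \<in> simplex2 \<and> boundary_map \<theta> l_free = l_free"
  proof -
  assume "\<theta> > 1"
  then have "(1 + (\<theta> - 1) / 3)\<^sup>2 \<noteq> 0" by (simp add: field_simps)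
  then show ?thesis
    by (simp add: l_free_def simplex2_def boundary_map_def vec_eq_iff)
qed

lemma l_minus_fixed:
  assumes "\<theta> > 4"
  shows "l_minus \<theta> i \<in> simplex2 \<and> boundary_map \<theta> (l_minus \<theta> i) = l_minus \<theta> i"
proof -
  define y where "y = (\<theta> - 1 - sqrt ((\<theta> - 1)\<^sup>2 - 8)) / 2"
  define x where "x = x_minus \<theta>"
  have xy: "x = y\<^sup>2" by (simp add: x_def x_minus_def y_def)
  have "(3::real)\<^sup>2 \<le> (\<theta> - 1)\<^sup>2" using assms by (intro power_mono) auto
  then have "(sqrt ((\<theta> - 1)\<^sup>2 - 8))\<^sup>2 = (\<theta> - 1)\<^sup>2 - 8" by simp
  moreover have "sqrt ((\<theta> - 1)\<^sup>2 - 8) = \<theta> - 1 - 2 * y" by (simp add: y_def field_simps)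
  ultimately have "(\<theta> - 1 - 2 * y)\<^sup>2 = (\<theta> - 1)\<^sup>2 - 8" by simp
  then have quad: "y\<^sup>2 - (\<theta> - 1) * y + 2 = 0"
    by (simp add: power2_eq_square algebra_simps)
  have "y * (x + \<theta> + 1) - (\<theta> * x + 2) = (y - 1) * (y\<^sup>2 - (\<theta> - 1) * y + 2)"
    by (simp add: xy power2_eq_square algebra_simps)
  then have rec: "\<theta> * x + 2 = y * (x + \<theta> + 1)" by (simp add: quad)
  have x0: "x \<ge> 0" by (simp add: xy)
  have li: "l_minus \<theta> i $ i = x / (x + 2)" by (simp add: l_minus_def x_def)
  have lo: "l_minus \<theta> i $ a = 1 / (x + 2)" if "a \<noteq> i" for a
    using that by (simp add: l_minus_def x_def)
  define c where "c = (x + \<theta> + 1) / (x + 2)"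
  have c: "c > 0" using x0 assms by (simp add: c_def)
  have "1 + (\<theta> - 1) * l_minus \<theta> i $ i = (\<theta> * x + 2) / (x + 2)"
    using x0 by (simp add: li field_simps)
  then have wi: "1 + (\<theta> - 1) * l_minus \<theta> i $ i = y * c" by (simp add: rec c_def)
  have wo: "1 + (\<theta> - 1) * l_minus \<theta> i $ a = c" if "a \<noteq> i" for a
    using x0 that by (simp add: lo c_def field_simps)
  have card2: "card (UNIV - {i}) = 2" by (simp add: card_Diff_singleton)
  have "(\<Sum>b\<in>UNIV. (1 + (\<theta> - 1) * l_minus \<theta> i $ b)\<^sup>2)
      = (y * c)\<^sup>2 + (\<Sum>b\<in>UNIV - {i}. (1 + (\<theta> - 1) * l_minus \<theta> i $ b)\<^sup>2)"
    by (subst sum.remove[of UNIV i]) (simp_all add: wi)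
  also have "(\<Sum>b\<in>UNIV - {i}. (1 + (\<theta> - 1) * l_minus \<theta> i $ b)\<^sup>2) = (\<Sum>b\<in>UNIV - {i}. c\<^sup>2)"
    by (rule sum.cong) (simp_all add: wo)
  finally have den: "(\<Sum>b\<in>UNIV. (1 + (\<theta> - 1) * l_minus \<theta> i $ b)\<^sup>2) = (x + 2) * c\<^sup>2"
    by (simp add: card2 xy power_mult_distrib algebra_simps)
  have "boundary_map \<theta> (l_minus \<theta> i) $ a = l_minus \<theta> i $ a" for a
  proof -
    have "boundary_map \<theta> (l_minus \<theta> i) $ a
        = (1 + (\<theta> - 1) * l_minus \<theta> i $ a)\<^sup>2 / ((x + 2) * c\<^sup>2)"
      by (simp add: boundary_map_def den)
    also have "\<dots> = (if a = i then (y * c)\<^sup>2 else c\<^sup>2) / ((x + 2) * c\<^sup>2)"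
      by (cases "a = i") (simp_all only: wi wo if_True if_False simp_thms)
    also have "\<dots> = (if a = i then x else 1) / (x + 2)"
      using c by (simp add: xy power_mult_distrib)
    also have "\<dots> = l_minus \<theta> i $ a"
      by (simp add: li lo)
    finally show ?thesis .
  qed
  moreover have "(\<Sum>a\<in>UNIV. l_minus \<theta> i $ a) = 1"
  proof -
    have "(\<Sum>a\<in>UNIV. l_minus \<theta> i $ a) = x / (x + 2) + (\<Sum>a\<in>UNIV - {i}. l_minus \<theta> i $ a)"
      by (subst sum.remove[of UNIV i]) (simp_all add: li)
    also have "(\<Sum>a\<in>UNIV - {i}. l_minus \<theta> i $ a) = (\<Sum>a\<in>UNIV - {i}. 1 / (x + 2))"
      by (rule sum.cong) (simp_all add: lo)
    finally show ?thesis using x0 by (simp add: card2 add_divide_distrib[symmetric])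
  qed
  moreover have "0 \<le> l_minus \<theta> i $ a" for a
    using x0 by (cases "a = i") (simp_all add: li lo)
  ultimately show ?thesis by (simp add: simplex2_def vec_eq_iff)
qed


section \<open>The measure of a boundary law and its time evolution\<close>

definition bl_weight :: "'v set set \<Rightarrow> real \<Rightarrow> real^3 \<Rightarrow> 'v set \<Rightarrow> ('v \<Rightarrow> 3) \<Rightarrow> real" where
  "bl_weight E \<beta> l L \<omega> =
     (\<Prod>e\<in>{e \<in> E. e \<inter> L \<noteq> {}}. edge_weight \<beta> \<omega> e) * (\<Prod>z\<in>outer_boundary E L. l $ \<omega> z)"

definition bl_partition :: "'v set set \<Rightarrow> real \<Rightarrow> real^3 \<Rightarrow> 'v set \<Rightarrow> real" where
  "bl_partition E \<beta> l L =
     (\<Sum>\<omega> \<in> (\<Pi>\<^sub>E x\<in>L \<union> outer_boundary E L. (UNIV :: 3 set)). bl_weight E \<beta> l L \<omega>)"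

definition is_boundary_law_measure ::
    "'v set set \<Rightarrow> real \<Rightarrow> real^3 \<Rightarrow> ('v \<Rightarrow> 3) measure \<Rightarrow> bool" where
  "is_boundary_law_measure E \<beta> l \<mu> \<longleftrightarrow>
     prob_space \<mu> \<and> sets \<mu> = sets (\<Pi>\<^sub>M x\<in>UNIV. count_space UNIV) \<and>
     (\<forall>L \<omega>. finite L \<longrightarrow> L \<noteq> {} \<longrightarrow> connected_in E L \<longrightarrow>
        \<P>(\<sigma> in \<mu>. \<forall>x\<in>L \<union> outer_boundary E L. \<sigma> x = \<omega> x)
          = bl_weight E \<beta> l L \<omega> / bl_partition E \<beta> l L)"

definition spin_transition :: "real \<Rightarrow> 3 \<Rightarrow> 3 \<Rightarrow> real" where
  "spin_transition t a b = 1 / 3 + (of_bool (a = b) - 1 / 3) * exp (- (3 / 2) * t)"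

definition spin_kernel :: "real \<Rightarrow> ('v \<Rightarrow> 3) \<Rightarrow> ('v \<Rightarrow> 3) measure" where
  "spin_kernel t \<sigma> =
     (\<Pi>\<^sub>M x\<in>UNIV. point_measure UNIV (\<lambda>b. ennreal (spin_transition t (\<sigma> x) b)))"

definition time_evolved :: "('v \<Rightarrow> 3) measure \<Rightarrow> real \<Rightarrow> ('v \<Rightarrow> 3) measure" where
  "time_evolved \<mu> t = Giry_Monad.bind \<mu> (spin_kernel t)"

definition cond_spin_prob ::
    "('v \<Rightarrow> 3) measure \<Rightarrow> 'v \<Rightarrow> 3 \<Rightarrow> 'v set \<Rightarrow> 'v set \<Rightarrow> ('v \<Rightarrow> 3) \<Rightarrow> 3 \<Rightarrow> real" where
  "cond_spin_prob M r j L D \<eta> a =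
     \<P>(\<zeta> in M. \<zeta> r = j \<bar> (\<forall>x\<in>L - {r}. \<zeta> x = \<eta> x) \<and> (\<forall>x\<in>D - L. \<zeta> x = a))"

end

theory Submission
  imports Defs
begin

text \<open>
  The conditional law of the time-evolved spin at the root is that of a Potts model on a finite
  ball in which the spins outside the root carry the weak fields \<open>P\<^sub>t(\<sigma>\<^sub>x, \<eta>\<^sub>x)\<close> and the outer sphere
  carries \<open>l\<close>. Say that spin \<open>j\<close> \<open>c\<close>-dominates a message if its weight is at least \<open>c\<close> times every
  other weight. One step of the recursion turns \<open>c\<close>-domination into \<open>g(c)\<^sup>2\<close>-domination, up to the
  field, where \<open>g(c) = (\<theta> c + 2) / (c + \<theta> + 1)\<close>. For \<open>\<theta> > 4\<close> one has \<open>g(c)\<^sup>2 \<ge> c\<close> on \<open>[1,4]\<close> and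
  \<open>g(4)\<^sup>2 > 4\<close>. Hence \<open>4\<close>-domination survives arbitrary fields once \<open>t\<close> is large, whatever \<open>\<eta>\<close> is,
  and a constant field \<open>j\<close> amplifies domination geometrically up to \<open>4\<close>. Both \<open>l\<^sub>-\<close> (because
  \<open>x\<^sub>- \<le> 1\<close>) and the uniform boundary law are \<open>1\<close>-dominated by \<open>j\<close> and by \<open>k\<close>, so a sufficiently thick annulus of
  spins \<open>j\<close> (respectively \<open>k\<close>) makes \<open>j\<close> (respectively \<open>k\<close>) \<open>4\<close>-dominant at the root.
\<close>

subsection \<open>The tree seen from its root\<close>

text \<open>The path is extended at its head; if the new vertex already occurs on it, the path is
  cut back to start at that occurrence.\<close>

lemma rtranclp_imp_distinct_path:
  assumes "P\<^sup>*\<^sup>* x y"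
  shows "\<exists>xs. xs \<noteq> [] \<and> hd xs = x \<and> last xs = y \<and> distinct xs \<and> successively P xs"
  using assms
proof (induction rule: converse_rtranclp_induct)
  case base
  show ?case by (rule exI[of _ "[y]"]) simp
next
  case (step x z)
  then obtain xs where xs: "xs \<noteq> []" "hd xs = z" "last xs = y" "distinct xs" "successively P xs"
    by blast
  show ?case
  proof (cases "x \<in> set xs")
    case True
    then obtain us vs where "xs = us @ x # vs" by (meson split_list)
    with xs show ?thesis
      by (intro exI[of _ "x # vs"]) (auto simp: successively_append_iff split: if_splits)
  next
    case False
    with xs step.hyps show ?thesis
      by (intro exI[of _ "x # xs"]) (cases xs; auto)
  qed
qed

text \<open>A configuration on the union is the same as the pair of its restrictions, so this is
  Fubini for finite sums.\<close>

lemma sum_PiE_Un_disjoint: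
  assumes "A \<inter> B = {}"
  shows "(\<Sum>\<omega>\<in>PiE (A \<union> B) X. f \<omega>)
       = (\<Sum>\<omega>\<in>PiE A X. \<Sum>\<tau>\<in>PiE B X. f (\<lambda>x. if x \<in> A then \<omega> x else \<tau> x))"
proof -
  have "(\<Sum>\<omega>\<in>PiE (A \<union> B) X. f \<omega>)
      = (\<Sum>(\<omega>, \<tau>)\<in>PiE A X \<times> PiE B X. f (\<lambda>x. if x \<in> A then \<omega> x else \<tau> x))"
  proof (rule sum.reindex_bij_witness[where
        j = "\<lambda>\<omega>. (restrict \<omega> A, restrict \<omega> B)" and
        i = "\<lambda>(\<omega>, \<tau>) x. if x \<in> A then \<omega> x else \<tau> x"], goal_cases)
    case (1 \<omega>)
    then show ?case by (auto simp: fun_eq_iff PiE_def extensional_def)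
  next
    case (2 \<omega>)
    then show ?case by auto
  next
    case (3 p)
    with assms show ?case
      by (auto simp: fun_eq_iff PiE_def extensional_def restrict_def)
  next
    case (4 p)
    with assms show ?case by (auto simp: PiE_def extensional_def Pi_def)
  next
    case (5 \<omega>)
    then show ?case by (auto intro!: arg_cong[of _ _ f] simp: fun_eq_iff PiE_def extensional_def)
  qed
  then show ?thesis by (simp add: sum.cartesian_product)
qed

locale rooted_cayley_tree =
  fixes E :: "'v set set" and r :: 'v
  assumes tree: "cayley_tree E"
begin

lemma edge_sym: "{x, y} \<in> E \<longleftrightarrow> {y, x} \<in> E"
  by (simp add: insert_commute)

lemma edgeE:
  assumes "e \<in> E" obtains x y where "e = {x, y}" "x \<noteq> y"
  using assms tree unfolding cayley_tree_def by (meson card_2_iff)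

lemma edge_pair: "e \<in> E \<Longrightarrow> \<exists>x y. e = {x, y}"
  by (rule edgeE) blast+

lemma no_loop: "{x, x} \<notin> E"
  using tree unfolding cayley_tree_def by fastforce

lemma card_neighbours: "card {y. {x, y} \<in> E} = 3"
  using tree unfolding cayley_tree_def by blast

lemma finite_neighbours: "finite {y. {x, y} \<in> E}"
  using card_neighbours[of x] card.infinite by fastforce

text \<open>The ball of radius \<open>R\<close> about \<open>r\<close>, built so that
  \<open>tball (Suc R)\<close> is \<open>tball R\<close> with its outer boundary, the kind of set on
  which a boundary law measure prescribes cylinder probabilities.\<close>

primrec tball :: "nat \<Rightarrow> 'v set" where
  "tball 0 = {r}"
| "tball (Suc R) = tball R \<union> outer_boundary E (tball R)"

lemma root_in_tball: "r \<in> tball R"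
  by (induction R) auto

lemma tball_mono: "m \<le> n \<Longrightarrow> tball m \<subseteq> tball n"
  by (rule lift_Suc_mono_le) auto

lemma neighbour_in_tball: "x \<in> tball R \<Longrightarrow> {x, y} \<in> E \<Longrightarrow> y \<in> tball (Suc R)"
  by (auto simp: outer_boundary_def)

lemma finite_tball: "finite (tball R)"
proof (induction R)
  case (Suc R)
  have "outer_boundary E (tball R) \<subseteq> (\<Union>x\<in>tball R. {y. {x, y} \<in> E})"
    by (auto simp: outer_boundary_def)
  then show ?case using Suc finite_neighbours by (auto intro: finite_subset)
qed simp

lemma finite_boundary: "finite (outer_boundary E (tball R))"
  using finite_tball[of "Suc R"] by simp

lemma boundary_disjoint: "tball R \<inter> outer_boundary E (tball R) = {}"
  by (auto simp: outer_boundary_def)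

lemma finite_edges_in_tball: "finite {e \<in> E. e \<subseteq> tball R}"
  using finite_tball by simp

lemma tball_exhausts: "\<exists>R. x \<in> tball R"
proof -
  have "(\<lambda>u v. u \<in> UNIV \<and> v \<in> UNIV \<and> {u, v} \<in> E)\<^sup>*\<^sup>* r x"
    using tree unfolding cayley_tree_def connected_in_def by blast
  then show ?thesis
  proof (induction rule: rtranclp_induct)
    case base
    show ?case using root_in_tball by blast
  next
    case (step y z)
    then show ?case using neighbour_in_tball by blast
  qed
qed

lemma finite_subset_tball: "finite L \<Longrightarrow> \<exists>R. L \<subseteq> tball R"
proof (induction rule: finite_induct)
  case (insert x L)
  then obtain R S where "L \<subseteq> tball R" "x \<in> tball S" using tball_exhausts by blast
  then have "insert x L \<subseteq> tball (max R S)"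
    using tball_mono[of R "max R S"] tball_mono[of S "max R S"] by auto
  then show ?case ..
qed simp

lemma root_connected:
  "x \<in> tball R \<Longrightarrow> (\<lambda>u v. u \<in> tball R \<and> v \<in> tball R \<and> {u, v} \<in> E)\<^sup>*\<^sup>* r x"
proof (induction R arbitrary: x)
  case (Suc R)
  have up: "(\<lambda>u v. u \<in> tball (Suc R) \<and> v \<in> tball (Suc R) \<and> {u, v} \<in> E)\<^sup>*\<^sup>* r y"
    if "y \<in> tball R" for y
    by (rule rtranclp_mono[THEN predicate2D, OF _ Suc.IH[OF that]]) auto
  show ?case
  proof (cases "x \<in> tball R")
    case False
    with Suc.prems obtain y where y: "y \<in> tball R" "{y, x} \<in> E"
      by (auto simp: outer_boundary_def)
    from up[OF y(1)] show ?thesis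
      by (rule rtranclp.rtrancl_into_rtrancl) (use y Suc.prems in auto)
  qed (rule up)
qed simp

text \<open>Any two vertices are joined through the root. Connectedness matters because
  \<open>is_boundary_law_measure\<close> prescribes probabilities for connected sets only.\<close>

lemma connected_tball: "connected_in E (tball R)"
  unfolding connected_in_def
proof (intro ballI)
  fix x y assume xy: "x \<in> tball R" "y \<in> tball R"
  let ?P = "\<lambda>u v. u \<in> tball R \<and> v \<in> tball R \<and> {u, v} \<in> E"
  have "symp ?P" by (auto simp: symp_def insert_commute)
  then have "?P\<^sup>*\<^sup>* x r"
    by (rule symp_rtranclp[THEN sympD, OF _ root_connected[OF xy(1)]])
  with root_connected[OF xy(2)] show "?P\<^sup>*\<^sup>* x y" by (rule rtranclp_trans[rotated])
qed

text \<open>The path has to stay inside the ball so that it remains distinct when outside vertices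
  are attached to close it into a cycle.\<close>

lemma simple_path_in_tball:
  assumes "x \<in> tball R" "y \<in> tball R"
  obtains xs where "xs \<noteq> []" "hd xs = x" "last xs = y" "distinct xs"
    "successively (\<lambda>u v. {u, v} \<in> E) xs" "set xs \<subseteq> tball R"
proof -
  let ?P = "\<lambda>u v. u \<in> tball R \<and> v \<in> tball R \<and> {u, v} \<in> E"
  obtain xs where xs: "xs \<noteq> []" "hd xs = x" "last xs = y" "distinct xs" "successively ?P xs"
    using rtranclp_imp_distinct_path connected_tball assms unfolding connected_in_def by meson
  have "successively ?P zs \<Longrightarrow> hd zs \<in> tball R \<Longrightarrow> set zs \<subseteq> tball R" for zs
  proof (induction zs)
    case (Cons z zs)
    then show ?case by (cases zs) auto
  qed simp
  moreover have "successively (\<lambda>u v. {u, v} \<in> E) xs"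
    by (rule successively_mono[OF xs(5)]) auto
  moreover have "hd xs \<in> tball R" using xs assms by simp
  ultimately show ?thesis using xs(5) by (intro that[OF xs(1-4)])
qed

lemma acyclic:
  assumes "3 \<le> length xs" "distinct xs" "successively (\<lambda>u v. {u, v} \<in> E) xs"
    "{last xs, hd xs} \<in> E"
  shows False
proof -
  have "acyclic_edges E" using tree by (simp add: cayley_tree_def)
  then show False unfolding acyclic_edges_def
    by (rule notE) (intro exI[of _ xs] conjI assms)
qed

text \<open>Two different neighbours of \<open>x\<close> in the ball would be joined by a simple
  path in the ball, which closes to a cycle through \<open>x\<close>.\<close>

lemma parent_unique:
  assumes "x \<notin> tball R" "y \<in> tball R" "z \<in> tball R" "{x, y} \<in> E" "{x, z} \<in> E"
  shows "y = z"
proof (rule ccontr)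
  assume "y \<noteq> z"
  obtain xs where xs: "xs \<noteq> []" "hd xs = y" "last xs = z" "distinct xs"
    "successively (\<lambda>u v. {u, v} \<in> E) xs" "set xs \<subseteq> tball R"
    using simple_path_in_tball assms by metis
  obtain b bs where "xs = y # b # bs"
    using xs(1-3) \<open>y \<noteq> z\<close> by (cases xs; cases "tl xs") auto
  with xs assms edge_sym show False
    by (intro acyclic[of "x # xs"]) auto
qed

text \<open>An edge inside the sphere would close a simple path between inner neighbours of
  \<open>x\<close> and \<open>y\<close> to a cycle.\<close>

lemma boundary_independent:
  assumes "x \<in> outer_boundary E (tball R)" "y \<in> outer_boundary E (tball R)"
  shows "{x, y} \<notin> E"
proof
  assume e: "{x, y} \<in> E"
  obtain u v where uv: "x \<notin> tball R" "y \<notin> tball R" "u \<in> tball R" "v \<in> tball R"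
    "{u, x} \<in> E" "{v, y} \<in> E"
    using assms by (auto simp: outer_boundary_def)
  have "x \<noteq> y" using e no_loop by auto
  obtain xs where xs: "xs \<noteq> []" "hd xs = u" "last xs = v" "distinct xs"
    "successively (\<lambda>u v. {u, v} \<in> E) xs" "set xs \<subseteq> tball R"
    using simple_path_in_tball uv by metis
  show False
  proof (rule acyclic[of "x # xs @ [y]"])
    \<comment> \<open>The inner path may be a single vertex, when \<open>x\<close> and
      \<open>y\<close> have a common inner neighbour; the cycle is then a triangle.\<close>
    show "3 \<le> length (x # xs @ [y])" using xs(1) by (cases xs) auto
    show "distinct (x # xs @ [y])" using xs uv \<open>x \<noteq> y\<close> by auto
    show "successively (\<lambda>u v. {u, v} \<in> E) (x # xs @ [y])"
      using xs uv edge_sym by (auto simp: successively_Cons successively_append_iff)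
    show "{last (x # xs @ [y]), hd (x # xs @ [y])} \<in> E" using e edge_sym by simp
  qed
qed

section \<open>Children, parents and the edges of a ball\<close>

definition children :: "nat \<Rightarrow> 'v \<Rightarrow> 'v set" where
  "children R y = {x \<in> outer_boundary E (tball R). {x, y} \<in> E}"

lemma finite_children: "finite (children R y)"
  using finite_boundary by (simp add: children_def)

lemma children_inner: "y \<in> tball R \<Longrightarrow> children (Suc R) y = {}"
  using neighbour_in_tball edge_sym by (fastforce simp: children_def outer_boundary_def)

text \<open>One of the three neighbours is the parent; the other two are neither in
  \<open>tball R\<close>, by uniqueness of the parent, nor on the same sphere. The lower bound has
  the form that also covers the root, which has three children.\<close>

lemma card_children_boundary:
  assumes "y \<in> outer_boundary E (tball R)"
  shows "2 \<le> card (children (Suc R) y)"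
proof -
  obtain p where p: "p \<in> tball R" "{p, y} \<in> E" "y \<notin> tball R"
    using assms by (auto simp: outer_boundary_def)
  have "{x. {y, x} \<in> E} - {p} \<subseteq> children (Suc R) y"
  proof
    fix x assume x: "x \<in> {x. {y, x} \<in> E} - {p}"
    then have "x \<notin> tball R" using parent_unique[of y R x p] p edge_sym by auto
    moreover have "x \<notin> outer_boundary E (tball R)"
      using boundary_independent[OF assms] x by auto
    ultimately show "x \<in> children (Suc R) y"
      using x assms edge_sym[of x y] unfolding children_def outer_boundary_def[of E "tball (Suc R)"]
      by auto
  qed
  from card_mono[OF finite_children this] show ?thesis
    using p edge_sym card_neighbours[of y] by (simp add: finite_neighbours)
qed

lemma card_children_root: "2 \<le> card (children 0 r)"
proof -
  have "children 0 r = {x. {r, x} \<in> E}"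
    using no_loop edge_sym by (auto simp: children_def outer_boundary_def)
  then show ?thesis using card_neighbours[of r] by simp
qed

definition parent :: "nat \<Rightarrow> 'v \<Rightarrow> 'v" where
  "parent R x = (THE y. y \<in> tball R \<and> {x, y} \<in> E)"

lemma parent:
  assumes "x \<in> outer_boundary E (tball R)"
  shows "parent R x \<in> tball R" "{x, parent R x} \<in> E"
proof -
  obtain y where y: "y \<in> tball R" "{y, x} \<in> E" "x \<notin> tball R"
    using assms by (auto simp: outer_boundary_def)
  then have "\<exists>!y. y \<in> tball R \<and> {x, y} \<in> E" using parent_unique edge_sym by metis
  from theI'[OF this] show "parent R x \<in> tball R" "{x, parent R x} \<in> E"
    by (simp_all add: parent_def)
qed

lemma parent_eq_iff:
  assumes "x \<in> outer_boundary E (tball R)" "y \<in> tball R"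
  shows "parent R x = y \<longleftrightarrow> {x, y} \<in> E"
  using parent[OF assms(1)] parent_unique[of x R] assms by (auto simp: outer_boundary_def)

text \<open>As no edge lies inside the sphere, an edge of the larger ball must touch the smaller
  one. This puts the edge set of \<open>bl_weight\<close> into the form to which the shell recursion
  applies.\<close>

lemma edges_touching_tball: "{e \<in> E. e \<inter> tball R \<noteq> {}} = {e \<in> E. e \<subseteq> tball (Suc R)}"
proof (intro set_eqI iffI)
  fix e assume "e \<in> {e \<in> E. e \<inter> tball R \<noteq> {}}"
  then obtain x where e: "e \<in> E" "x \<in> e" "x \<in> tball R" by auto
  then obtain y where "e = {x, y}" using edge_pair[of e] by (auto simp: insert_commute)
  with e show "e \<in> {e \<in> E. e \<subseteq> tball (Suc R)}" using neighbour_in_tball by auto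
next
  fix e assume e: "e \<in> {e \<in> E. e \<subseteq> tball (Suc R)}"
  then obtain x y where "e = {x, y}" using edge_pair by blast
  with e show "e \<in> {e \<in> E. e \<inter> tball R \<noteq> {}}" using boundary_independent by auto
qed

text \<open>A new edge has exactly one end on the new sphere and its other end is the parent of that
  vertex, so the sphere indexes the new edges.\<close>

lemma edges_in_tball_Suc:
  "{e \<in> E. e \<subseteq> tball (Suc R)}
     = {e \<in> E. e \<subseteq> tball R} \<union> (\<lambda>x. {x, parent R x}) ` outer_boundary E (tball R)"
proof (intro set_eqI iffI)
  fix e assume e: "e \<in> {e \<in> E. e \<subseteq> tball (Suc R)}"
  show "e \<in> {e \<in> E. e \<subseteq> tball R} \<union> (\<lambda>x. {x, parent R x}) ` outer_boundary E (tball R)"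
  proof (cases "e \<subseteq> tball R")
    case False
    then obtain x where x: "x \<in> e" "x \<notin> tball R" by blast
    then obtain y where xy: "e = {x, y}" "x \<notin> tball R"
      using e edge_pair[of e] by (auto simp: insert_commute)
    then have x: "x \<in> outer_boundary E (tball R)" using e by auto
    then have "y \<in> tball R" using e xy boundary_independent by auto
    then show ?thesis using x xy e parent_eq_iff by auto
  qed (use e in auto)
next
  fix e assume "e \<in> {e \<in> E. e \<subseteq> tball R} \<union> (\<lambda>x. {x, parent R x}) ` outer_boundary E (tball R)"
  then show "e \<in> {e \<in> E. e \<subseteq> tball (Suc R)}"
    using parent by auto
qed

lemma prod_edges_tball_Suc:
  fixes w :: "'v set \<Rightarrow> 'b::comm_monoid_mult"
  shows "(\<Prod>e\<in>{e \<in> E. e \<subseteq> tball (Suc R)}. w e)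
    = (\<Prod>e\<in>{e \<in> E. e \<subseteq> tball R}. w e) * (\<Prod>x\<in>outer_boundary E (tball R). w {x, parent R x})"
proof -
  have "inj_on (\<lambda>x. {x, parent R x}) (outer_boundary E (tball R))"
  proof (rule inj_onI)
    fix x y
    assume xy: "x \<in> outer_boundary E (tball R)" "y \<in> outer_boundary E (tball R)"
      and eq: "{x, parent R x} = {y, parent R y}"
    have "x \<noteq> parent R y" using parent(1)[OF xy(2)] xy(1) by (auto simp: outer_boundary_def)
    with eq show "x = y" by (auto simp: doubleton_eq_iff)
  qed
  moreover have "{e \<in> E. e \<subseteq> tball R} \<inter> (\<lambda>x. {x, parent R x}) ` outer_boundary E (tball R) = {}"
    by (auto simp: outer_boundary_def)
  ultimately show ?thesis
    unfolding edges_in_tball_Suc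
    using finite_edges_in_tball finite_boundary by (simp add: prod.union_disjoint prod.reindex)
qed

text \<open>Every vertex of the sphere has exactly one parent, so the sets of children partition the
  sphere.\<close>

lemma prod_boundary_group:
  fixes g :: "'v \<Rightarrow> 'v \<Rightarrow> 'b::comm_monoid_mult"
  shows "(\<Prod>x\<in>outer_boundary E (tball R). g (parent R x) x)
    = (\<Prod>y\<in>tball R. \<Prod>x\<in>children R y. g y x)"
proof -
  have "(\<Prod>y\<in>tball R. \<Prod>x\<in>{x \<in> outer_boundary E (tball R). parent R x = y}. g (parent R x) x)
      = (\<Prod>x\<in>outer_boundary E (tball R). g (parent R x) x)"
    using parent finite_tball finite_boundary by (intro prod.group) auto
  moreover have "(\<Prod>x\<in>{x \<in> outer_boundary E (tball R). parent R x = y}. g (parent R x) x)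
      = (\<Prod>x\<in>children R y. g y x)" if "y \<in> tball R" for y
    using that parent_eq_iff by (intro prod.cong) (auto simp: children_def)
  ultimately show ?thesis by simp
qed

subsection \<open>Summing out the outermost shell\<close>

text \<open>The unnormalised weight of root spin \<open>a\<close> in the Potts model on
  \<open>tball R\<close> with single-site weights \<open>\<phi>\<close>.\<close>

definition root_sum :: "real \<Rightarrow> ('v \<Rightarrow> 3 \<Rightarrow> real) \<Rightarrow> nat \<Rightarrow> 3 \<Rightarrow> real" where
  "root_sum \<beta> \<phi> R a =
     (\<Sum>\<omega>\<in>PiE (tball R) (\<lambda>x. if x = r then {a} else UNIV).
        (\<Prod>e\<in>{e \<in> E. e \<subseteq> tball R}. edge_weight \<beta> \<omega> e) * (\<Prod>x\<in>tball R. \<phi> x (\<omega> x)))"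

text \<open>The site weight of \<open>y\<close> after the spins on the sphere around
  \<open>tball R\<close> have been summed out: each child contributes its message as a
  factor.\<close>

definition absorb :: "real \<Rightarrow> nat \<Rightarrow> ('v \<Rightarrow> 3 \<Rightarrow> real) \<Rightarrow> 'v \<Rightarrow> 3 \<Rightarrow> real" where
  "absorb \<beta> R \<phi> y b = \<phi> y b * (\<Prod>x\<in>children R y. \<Sum>c\<in>UNIV. potts_Q \<beta> c b * \<phi> x c)"

lemma edge_weight_cong:
  assumes "e \<in> E" "\<And>x. x \<in> e \<Longrightarrow> \<omega> x = \<omega>' x"
  shows "edge_weight \<beta> \<omega> e = edge_weight \<beta> \<omega>' e"
  using assms(1) by (rule edgeE) (use assms(2) in \<open>simp add: edge_weight_pair\<close>)

lemma root_sum_0: "root_sum \<beta> \<phi> 0 a = \<phi> r a"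
proof -
  have "{e \<in> E. e \<subseteq> {r}} = {}"
    using no_loop by (auto simp: subset_singleton_iff elim!: edgeE)
  then show ?thesis unfolding root_sum_def tball.simps by (simp only: prod.empty) (simp add: PiE_insert_eq)
qed

text \<open>Spins of the outer sphere interact only with their parents, so, given the inner spins,
  the sum over them factorises over the sphere and can be collected at the parents.\<close>

lemma root_sum_Suc: "root_sum \<beta> \<phi> (Suc R) a = root_sum \<beta> (absorb \<beta> R \<phi>) R a"
proof -
  let ?A = "tball R" and ?O = "outer_boundary E (tball R)"
  let ?X = "\<lambda>x. if x = r then {a} else (UNIV :: 3 set)"
  let ?w = "\<lambda>\<omega>. \<Prod>e\<in>{e \<in> E. e \<subseteq> tball R}. edge_weight \<beta> \<omega> e"
  let ?m = "\<lambda>\<omega> \<tau> x. if x \<in> ?A then \<omega> x else \<tau> x"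
  have O: "x \<notin> ?A" "x \<noteq> r" if "x \<in> ?O" for x
    using that root_in_tball[of R] by (auto simp: outer_boundary_def)
  have split: "(\<Prod>e\<in>{e \<in> E. e \<subseteq> tball (Suc R)}. edge_weight \<beta> (?m \<omega> \<tau>) e)
        * (\<Prod>x\<in>tball (Suc R). \<phi> x (?m \<omega> \<tau> x))
      = ?w \<omega> * (\<Prod>x\<in>?A. \<phi> x (\<omega> x))
        * (\<Prod>x\<in>?O. potts_Q \<beta> (\<tau> x) (\<omega> (parent R x)) * \<phi> x (\<tau> x))" for \<omega> \<tau>
  proof -
    have "(\<Prod>x\<in>tball (Suc R). \<phi> x (?m \<omega> \<tau> x))
        = (\<Prod>x\<in>?A. \<phi> x (?m \<omega> \<tau> x)) * (\<Prod>x\<in>?O. \<phi> x (?m \<omega> \<tau> x))"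
      using finite_tball finite_boundary boundary_disjoint by (simp add: prod.union_disjoint)
    moreover have "(\<Prod>x\<in>?O. \<phi> x (?m \<omega> \<tau> x)) = (\<Prod>x\<in>?O. \<phi> x (\<tau> x))"
      using O by (intro prod.cong) auto
    moreover have "?w (?m \<omega> \<tau>) = ?w \<omega>"
      by (intro prod.cong refl edge_weight_cong) auto
    moreover have "(\<Prod>x\<in>?O. edge_weight \<beta> (?m \<omega> \<tau>) {x, parent R x})
        = (\<Prod>x\<in>?O. potts_Q \<beta> (\<tau> x) (\<omega> (parent R x)))"
      using O parent by (intro prod.cong) (auto simp: edge_weight_pair)
    ultimately show ?thesis
      unfolding prod_edges_tball_Suc by (simp add: prod.distrib)
  qed
  have inner: "(\<Sum>\<tau>\<in>PiE ?O ?X. \<Prod>x\<in>?O. potts_Q \<beta> (\<tau> x) (\<omega> (parent R x)) * \<phi> x (\<tau> x))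
      = (\<Prod>y\<in>?A. \<Prod>x\<in>children R y. \<Sum>c\<in>UNIV. potts_Q \<beta> c (\<omega> y) * \<phi> x c)" for \<omega>
  proof -
    have "(\<Sum>\<tau>\<in>PiE ?O ?X. \<Prod>x\<in>?O. potts_Q \<beta> (\<tau> x) (\<omega> (parent R x)) * \<phi> x (\<tau> x))
        = (\<Prod>x\<in>?O. \<Sum>c\<in>?X x. potts_Q \<beta> c (\<omega> (parent R x)) * \<phi> x c)"
      using finite_boundary by (intro prod_sum_PiE[symmetric]) auto
    also have "\<dots> = (\<Prod>x\<in>?O. \<Sum>c\<in>UNIV. potts_Q \<beta> c (\<omega> (parent R x)) * \<phi> x c)"
      using O by (intro prod.cong) auto
    finally show ?thesis
      using prod_boundary_group[of "\<lambda>y x. \<Sum>c\<in>UNIV. potts_Q \<beta> c (\<omega> y) * \<phi> x c"] by simp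
  qed
  have "root_sum \<beta> \<phi> (Suc R) a
      = (\<Sum>\<omega>\<in>PiE ?A ?X. \<Sum>\<tau>\<in>PiE ?O ?X. ?w \<omega> * (\<Prod>x\<in>?A. \<phi> x (\<omega> x))
        * (\<Prod>x\<in>?O. potts_Q \<beta> (\<tau> x) (\<omega> (parent R x)) * \<phi> x (\<tau> x)))"
    unfolding root_sum_def split[symmetric]
    by (simp only: tball.simps sum_PiE_Un_disjoint[OF boundary_disjoint])
  also have "\<dots> = root_sum \<beta> (absorb \<beta> R \<phi>) R a"
    unfolding root_sum_def sum_distrib_left[symmetric] inner absorb_def
    by (simp add: prod.distrib mult.assoc)
  finally show ?thesis .
qed

lemma root_sum_pos:
  assumes "\<And>x a. 0 < \<phi> x a"
  shows "0 < root_sum \<beta> \<phi> R a"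
  using assms
proof (induction R arbitrary: \<phi>)
  case (Suc R)
  have "0 < absorb \<beta> R \<phi> x a" for x a
  proof -
    have "0 < (\<Sum>c\<in>UNIV. potts_Q \<beta> c a * \<phi> y c)" for y
      using Suc.prems by (intro sum_pos) (auto simp: potts_Q_def)
    then show ?thesis unfolding absorb_def using Suc.prems by (simp add: prod_pos)
  qed
  then show ?case using Suc.IH by (simp add: root_sum_Suc)
qed (simp add: root_sum_0)

end

subsection \<open>Dominance of one spin\<close>

definition dominant :: "real \<Rightarrow> 3 \<Rightarrow> (3 \<Rightarrow> real) \<Rightarrow> bool" where
  "dominant c j f \<longleftrightarrow> (\<forall>a. a \<noteq> j \<longrightarrow> c * f a \<le> f j)"

lemma dominant_mono:
  assumes "dominant c j f" "c' \<le> c" "\<And>a. 0 \<le> f a"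
  shows "dominant c' j f"
  using assms unfolding dominant_def by (meson mult_right_mono order_trans)

lemma third_spin:
  fixes a j :: 3
  assumes "a \<noteq> j"
  obtains b where "b \<noteq> a" "b \<noteq> j" "UNIV = {j, a, b}"
proof -
  have "card (UNIV - {j, a}) = 1"
    using assms by (simp add: card_Diff_subset)
  then obtain b where "UNIV - {j, a} = {b}" by (rule card_1_singletonE)
  then show ?thesis using that by blast
qed

lemma sum_spins:
  fixes f :: "3 \<Rightarrow> 'b::comm_monoid_add"
  assumes "a \<noteq> j" "b \<noteq> a" "b \<noteq> j" "UNIV = {j, a, b}"
  shows "(\<Sum>c\<in>UNIV. f c) = f j + (f a + f b)"
  unfolding assms(4) using assms(1-3) by (simp add: eq_commute)

section \<open>Messages along an edge and the gain of dominance\<close>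

definition message :: "real \<Rightarrow> (3 \<Rightarrow> real) \<Rightarrow> 3 \<Rightarrow> real" where
  "message \<beta> f b = (\<Sum>c\<in>UNIV. potts_Q \<beta> c b * f c)"

lemma message_eq: "message \<beta> f b = (\<Sum>c\<in>UNIV. f c) + (exp \<beta> - 1) * f b"
proof -
  have "message \<beta> f b = (\<Sum>c\<in>UNIV. f c + (if c = b then (exp \<beta> - 1) * f b else 0))"
    unfolding message_def by (intro sum.cong) (auto simp: potts_Q_def algebra_simps)
  then show ?thesis by (simp add: sum.distrib)
qed

lemma message_pos: "(\<And>a. 0 < f a) \<Longrightarrow> 0 < message \<beta> f b"
  unfolding message_def by (intro sum_pos) (auto simp: potts_Q_def)

text \<open>The ratio of the messages for \<open>j\<close> and for another spin in the extremal case
  of weight \<open>c\<close> at \<open>j\<close> and \<open>1\<close> at both other spins.\<close>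

definition gain :: "real \<Rightarrow> real \<Rightarrow> real" where
  "gain \<theta> c = (\<theta> * c + 2) / (c + \<theta> + 1)"

text \<open>After clearing denominators the claim is linear in the three weights and is a
  nonnegative combination of the two domination inequalities.\<close>

lemma dominant_message:
  assumes dom: "dominant c j f" and pos: "\<And>a. 0 \<le> f a" and c: "1 \<le> c" and \<beta>: "0 \<le> \<beta>"
  shows "dominant (gain (exp \<beta>) c) j (message \<beta> f)"
  unfolding dominant_def
proof (intro allI impI)
  fix a assume a: "a \<noteq> j"
  then obtain b where b: "b \<noteq> a" "b \<noteq> j" "UNIV = {j, a, b}" by (rule third_spin)
  define \<theta> where "\<theta> = exp \<beta>"
  have \<theta>: "1 \<le> \<theta>" using \<beta> by (simp add: \<theta>_def)
  have "c * f a \<le> f j" "c * f b \<le> f j" using dom a b by (auto simp: dominant_def)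
  then have "(\<theta> + 1) * (c * f a) + (c - 1) * f b + f a \<le> (\<theta> + 2) * f j"
  proof -
    assume h: "c * f a \<le> f j" "c * f b \<le> f j"
    \<comment> \<open>Multiplication by \<open>c\<close> makes both \<open>c * f a\<close> and
      \<open>c * f b\<close> appear, with coefficients that add up to
      \<open>c * (\<theta> + 2)\<close>.\<close>
    have "c * ((\<theta> + 1) * (c * f a) + (c - 1) * f b + f a)
        = ((\<theta> + 1) * c + 1) * (c * f a) + (c - 1) * (c * f b)"
      by (simp add: algebra_simps)
    also have "\<dots> \<le> ((\<theta> + 1) * c + 1) * f j + (c - 1) * f j"
      using h c \<theta> by (intro add_mono mult_left_mono) auto
    also have "\<dots> = c * ((\<theta> + 2) * f j)" by (simp add: algebra_simps)
    finally show ?thesis using c by simp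
  qed
  \<comment> \<open>The slack of this inequality, times \<open>\<theta> - 1\<close>, is the
    difference of the cross-multiplied sides of the claim.\<close>
  then have "0 \<le> (\<theta> - 1) * ((\<theta> + 2) * f j - ((\<theta> + 1) * (c * f a) + (c - 1) * f b + f a))"
    using \<theta> by (intro mult_nonneg_nonneg) auto
  also have "\<dots> = (c + \<theta> + 1) * message \<beta> f j - (\<theta> * c + 2) * message \<beta> f a"
    unfolding message_eq sum_spins[OF a b] \<theta>_def[symmetric] by (simp add: algebra_simps)
  finally show "gain (exp \<beta>) c * message \<beta> f a \<le> message \<beta> f j"
    using c \<theta> unfolding gain_def \<theta>_def[symmetric] by (simp add: field_simps)
qed

lemma gain_ge_1: "1 \<le> \<theta> \<Longrightarrow> 1 \<le> c \<Longrightarrow> 1 \<le> gain \<theta> c"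
proof -
  assume "1 \<le> \<theta>" "1 \<le> c"
  moreover from this have "0 \<le> (\<theta> - 1) * (c - 1)" by simp
  ultimately show ?thesis by (simp add: gain_def field_simps)
qed

text \<open>With \<open>s = sqrt c\<close> the inequality reads \<open>(s - 1) * (s\<^sup>2 - (\<theta> - 1) * s + 2) \<le> 0\<close>.\<close>

lemma gain_square_ge:
  assumes "4 \<le> \<theta>" "1 \<le> c" "c \<le> 4"
  shows "c \<le> (gain \<theta> c)\<^sup>2"
proof -
  define s where "s = sqrt c"
  have s: "c = s\<^sup>2" "1 \<le> s" "s \<le> 2"
    using assms by (auto simp: s_def intro: real_le_lsqrt)
  \<comment> \<open>At \<open>\<theta> = 4\<close> the quadratic factor is
    \<open>(s - 1) * (s - 2)\<close>; since \<open>s\<close> is positive, a larger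
    \<open>\<theta>\<close> only lowers it.\<close>
  have "(s - 2) * (s - 1) \<le> 0" using s by (intro mult_nonpos_nonneg) auto
  moreover have "3 * s \<le> (\<theta> - 1) * s" using s assms by (intro mult_right_mono) auto
  ultimately have "s\<^sup>2 - (\<theta> - 1) * s + 2 \<le> 0" by (simp add: power2_eq_square algebra_simps)
  then have "(s - 1) * (s\<^sup>2 - (\<theta> - 1) * s + 2) \<le> 0"
    using s by (intro mult_nonneg_nonpos) auto
  then have "s * (s\<^sup>2 + \<theta> + 1) \<le> \<theta> * s\<^sup>2 + 2" by (simp add: power2_eq_square algebra_simps)
  then have "s \<le> gain \<theta> c" unfolding gain_def s(1) using assms s
    by (subst pos_le_divide_eq) (auto intro: add_pos_nonneg add_nonneg_pos)
  then have "s\<^sup>2 \<le> (gain \<theta> c)\<^sup>2" using s by (intro power_mono) auto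
  then show ?thesis by (simp add: s(1))
qed

text \<open>For positive \<open>\<theta>\<close>, \<open>gain \<theta> 4 > 2\<close> amounts to
  \<open>\<theta> > 4\<close>. The strict excess leaves room for site weights that slightly favour a
  wrong spin.\<close>

lemma gain_4_gt: "4 < \<theta> \<Longrightarrow> 4 < (gain \<theta> 4)\<^sup>2"
proof -
  assume "4 < \<theta>"
  then have "2 < gain \<theta> 4" by (simp add: gain_def field_simps)
  then have "2\<^sup>2 < (gain \<theta> 4)\<^sup>2" by (intro power_strict_mono) auto
  then show ?thesis by simp
qed

section \<open>Propagation of dominance from the outer sphere to the root\<close>

context rooted_cayley_tree
begin

primrec shell :: "nat \<Rightarrow> 'v set" where
  "shell 0 = {r}"
| "shell (Suc R) = outer_boundary E (tball R)"

lemma shell_subset: "shell R \<subseteq> tball R"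
  by (cases R) auto

lemma shell_disjoint: "m < n \<Longrightarrow> tball m \<inter> shell n = {}"
proof (cases n)
  case (Suc k)
  assume "m < n"
  with Suc show ?thesis
    using tball_mono[of m k] boundary_disjoint[of k] by auto
qed simp

lemma absorb_message: "absorb \<beta> R \<phi> y b = \<phi> y b * (\<Prod>x\<in>children R y. message \<beta> (\<phi> x) b)"
  by (simp add: absorb_def message_def)

lemma absorb_pos: "(\<And>x a. 0 < \<phi> x a) \<Longrightarrow> 0 < absorb \<beta> R \<phi> y b"
  unfolding absorb_message by (intro mult_pos_pos prod_pos ballI message_pos) auto

lemma absorb_inner:
  assumes "y \<in> tball R" "y \<notin> shell R"
  shows "absorb \<beta> R \<phi> y = \<phi> y"
proof (cases R)
  case 0
  with assms show ?thesis by simp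
next
  case (Suc n)
  then have "children R y = {}" using assms children_inner by auto
  then show ?thesis by (simp add: absorb_def fun_eq_iff)
qed

text \<open>The message of each child carries the ratio \<open>gain\<close>, at least two children
  turn it into its square, and the weight of \<open>y\<close> itself contributes the factor
  \<open>s\<close>.\<close>

lemma absorb_shell:
  assumes pos: "\<And>x a. 0 < \<phi> x a" and y: "y \<in> shell R"
    and kids: "\<And>x. x \<in> shell (Suc R) \<Longrightarrow> dominant c j (\<phi> x)"
    and field: "dominant s j (\<phi> y)" and "0 \<le> s" "1 \<le> c" "0 \<le> \<beta>"
  shows "dominant (s * (gain (exp \<beta>) c)\<^sup>2) j (absorb \<beta> R \<phi> y)"
  unfolding dominant_def
proof (intro allI impI)
  fix a assume a: "a \<noteq> j"
  let ?g = "gain (exp \<beta>) c" and ?C = "children R y"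
  let ?P = "\<lambda>b. \<Prod>x\<in>?C. message \<beta> (\<phi> x) b"
  have msg: "0 < message \<beta> (\<phi> x) b" for x b using pos by (rule message_pos)
  have g: "1 \<le> ?g" using assms by (intro gain_ge_1) auto
  have "2 \<le> card ?C"
    using y card_children_root card_children_boundary by (cases R) auto
  \<comment> \<open>Since the gain is at least \<open>1\<close>, more than two children can only
    help.\<close>
  then have "?g\<^sup>2 * ?P a \<le> ?g ^ card ?C * ?P a"
    using g msg by (intro mult_right_mono power_increasing prod_nonneg) (auto intro: less_imp_le)
  also have "\<dots> = (\<Prod>x\<in>?C. ?g * message \<beta> (\<phi> x) a)" by (simp add: prod.distrib)
  also have "\<dots> \<le> ?P j"
  proof (intro prod_mono conjI)
    fix x assume "x \<in> ?C"
    then have "dominant c j (\<phi> x)" using kids by (simp add: children_def)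
    then have "dominant ?g j (message \<beta> (\<phi> x))"
      using pos assms by (intro dominant_message) (auto intro: less_imp_le)
    then show "?g * message \<beta> (\<phi> x) a \<le> message \<beta> (\<phi> x) j"
      using a by (simp add: dominant_def)
    show "0 \<le> ?g * message \<beta> (\<phi> x) a" using g msg[of x a] by simp
  qed
  finally have P: "?g\<^sup>2 * ?P a \<le> ?P j" .
  have "s * \<phi> y a \<le> \<phi> y j" using field a by (simp add: dominant_def)
  then have "(s * \<phi> y a) * (?g\<^sup>2 * ?P a) \<le> \<phi> y j * ?P j"
    using P pos[of y j] pos[of y a] \<open>0 \<le> s\<close> msg
    by (intro mult_mono) (auto intro!: mult_nonneg_nonneg prod_nonneg simp: less_imp_le)
  then show "s * ?g\<^sup>2 * absorb \<beta> R \<phi> y a \<le> absorb \<beta> R \<phi> y j"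
    by (simp add: absorb_message mult_ac)
qed

lemma root_sum_dominant_weak:
  assumes \<beta>: "4 < exp \<beta>" and pos: "\<And>x a. 0 < \<phi> x a"
    and weak: "\<And>y. y \<in> tball R \<Longrightarrow> dominant (4 / (gain (exp \<beta>) 4)\<^sup>2) j (\<phi> y)"
    and outer: "\<And>y. y \<in> shell R \<Longrightarrow> dominant 4 j (\<phi> y)"
  shows "dominant 4 j (root_sum \<beta> \<phi> R)"
  using pos weak outer
proof (induction R arbitrary: \<phi>)
  case 0
  then show ?case by (simp add: dominant_def root_sum_0)
next
  case (Suc R)
  let ?\<psi> = "absorb \<beta> R \<phi>" and ?s = "4 / (gain (exp \<beta>) 4)\<^sup>2"
  have "0 \<le> \<beta>"
  proof -
    have "1 < exp \<beta>" using \<beta> by linarith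
    then show ?thesis by simp
  qed
  have s: "0 < ?s" "?s \<le> 4" "?s * (gain (exp \<beta>) 4)\<^sup>2 = 4"
    using gain_4_gt[OF \<beta>] by (auto simp: divide_le_eq)
  have pos': "0 < ?\<psi> x a" for x a using Suc.prems(1) by (rule absorb_pos)
  have outer': "dominant 4 j (?\<psi> y)" if "y \<in> shell R" for y
  proof -
    have "dominant (?s * (gain (exp \<beta>) 4)\<^sup>2) j (?\<psi> y)"
      using that Suc.prems s \<open>0 \<le> \<beta>\<close> shell_subset[of R]
      by (intro absorb_shell) auto
    then show ?thesis by (simp only: s)
  qed
  \<comment> \<open>The new outer sphere meets the weak bound because dominance \<open>4\<close> is
    stronger; further inside the weights are unchanged.\<close>
  have "dominant ?s j (?\<psi> y)" if "y \<in> tball R" for y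
  proof (cases "y \<in> shell R")
    case True
    from outer'[OF this] show ?thesis
      by (rule dominant_mono) (use s pos' in \<open>auto intro: less_imp_le\<close>)
  next
    case False
    then show ?thesis using that Suc.prems by (simp add: absorb_inner)
  qed
  from Suc.IH[OF pos' this outer'] show ?case by (simp add: root_sum_Suc)
qed

text \<open>The annulus consists of the spheres of radii \<open>N\<close> to
  \<open>N + m - 1\<close>. Peeling across one of them multiplies the dominance by at least
  \<open>h\<close> until \<open>4\<close> is reached, because by \<open>gain_square_ge\<close> the
  tree step alone does not lower it. From there \<open>root_sum_dominant_weak\<close> leads to the
  root.\<close>

lemma root_sum_dominant:
  assumes \<beta>: "4 < exp \<beta>" and h: "1 \<le> h" and pos: "\<And>x a. 0 < \<phi> x a"
    and weak: "\<And>y. y \<in> tball (N + m) \<Longrightarrow> dominant (4 / (gain (exp \<beta>) 4)\<^sup>2) j (\<phi> y)"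
    and strong: "\<And>n y. N \<le> n \<Longrightarrow> n < N + m \<Longrightarrow> y \<in> shell n \<Longrightarrow> dominant h j (\<phi> y)"
    and outer: "\<And>y. y \<in> shell (N + m) \<Longrightarrow> dominant c j (\<phi> y)"
    and c: "1 \<le> c" "c \<le> 4" "4 \<le> c * h ^ m"
  shows "dominant 4 j (root_sum \<beta> \<phi> (N + m))"
  using pos weak strong outer c
proof (induction m arbitrary: \<phi> c)
  case 0
  then have "dominant 4 j (\<phi> y)" if "y \<in> shell N" for y
    using that by (intro dominant_mono[of c j "\<phi> y" 4]) (auto intro: less_imp_le)
  with 0 show ?case using root_sum_dominant_weak[OF \<beta>, of \<phi> N j] by simp
next
  case (Suc m)
  let ?R = "N + m"
  \<comment> \<open>The new dominance is capped at \<open>4\<close> because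
    \<open>gain_square_ge\<close> covers only values between \<open>1\<close> and
    \<open>4\<close>.\<close>
  let ?\<psi> = "absorb \<beta> ?R \<phi>" and ?s = "4 / (gain (exp \<beta>) 4)\<^sup>2" and ?c = "min 4 (h * c)"
  have "0 \<le> \<beta>"
  proof -
    have "1 < exp \<beta>" using \<beta> by linarith
    then show ?thesis by simp
  qed
  have s: "?s \<le> 1" using gain_4_gt[OF \<beta>] by (simp add: divide_le_eq)
  have hc: "1 \<le> h * c" using h Suc.prems(5) by (metis mult_mono' mult_1 zero_le_one)
  have pos': "0 < ?\<psi> x a" for x a using Suc.prems(1) by (rule absorb_pos)
  have nonneg': "0 \<le> ?\<psi> x a" for x a using pos' by (rule less_imp_le)
  have outer': "dominant ?c j (?\<psi> y)" if y: "y \<in> shell ?R" for y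
  proof -
    have "dominant (h * (gain (exp \<beta>) c)\<^sup>2) j (?\<psi> y)"
      using y Suc.prems(1,4,5) Suc.prems(3)[of ?R y] h \<open>0 \<le> \<beta>\<close>
      by (intro absorb_shell) auto
    moreover have "?c \<le> h * (gain (exp \<beta>) c)\<^sup>2"
    proof -
      have "h * c \<le> h * (gain (exp \<beta>) c)\<^sup>2"
        using h Suc.prems \<beta> by (intro mult_left_mono gain_square_ge) auto
      then show ?thesis by simp
    qed
    ultimately show ?thesis using nonneg' by (rule dominant_mono)
  qed
  have weak': "dominant ?s j (?\<psi> y)" if y: "y \<in> tball ?R" for y
  proof (cases "y \<in> shell ?R")
    case True
    from outer'[OF this] show ?thesis
      by (rule dominant_mono) (use s hc nonneg' in auto)
  next
    case False
    then show ?thesis using y Suc.prems(2)[of y] by (simp add: absorb_inner)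
  qed
  have strong': "dominant h j (?\<psi> y)" if "N \<le> n" "n < ?R" "y \<in> shell n" for n y
  proof -
    have "y \<in> tball ?R" "y \<notin> shell ?R"
      using that shell_subset[of n] tball_mono[of n ?R] shell_disjoint[of n ?R] by auto
    then show ?thesis using that Suc.prems(3)[of n y] by (simp add: absorb_inner)
  qed
  \<comment> \<open>Below the cap one factor \<open>h\<close> merely moves from the power into the
    dominance; at the cap the remaining power is at least \<open>1\<close>.\<close>
  have c': "4 \<le> ?c * h ^ m"
  proof (cases "h * c \<le> 4")
    case True
    then show ?thesis using Suc.prems(7) by (simp add: mult_ac)
  next
    case False
    then show ?thesis using one_le_power[OF h, of m] by simp
  qed
  have "dominant 4 j (root_sum \<beta> ?\<psi> ?R)"
    by (rule Suc.IH[OF pos' weak' strong' outer' _ _ c']) (use hc in auto)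
  then show ?case by (simp add: root_sum_Suc)
qed

end

subsection \<open>Cylinder probabilities of the time-evolved measure\<close>

lemma spin_transition_eq:
  "spin_transition t a b = (if a = b then 1 + 2 * exp (- (3 / 2) * t) else 1 - exp (- (3 / 2) * t)) / 3"
  by (simp add: spin_transition_def field_simps)

lemma spin_transition_nonneg: "0 \<le> t \<Longrightarrow> 0 \<le> spin_transition t a b"
  by (simp add: spin_transition_eq)

text \<open>The transition matrix is a combination of the all-ones matrix and the identity, with
  coefficients \<open>(1 - e) / 3\<close> and \<open>e\<close> for
  \<open>e = exp (- (3 / 2) * t)\<close>.\<close>

lemma sum_spin_transition_mult:
  "(\<Sum>a\<in>UNIV. spin_transition t a b * f a)
     = (1 - exp (- (3 / 2) * t)) / 3 * (\<Sum>a\<in>UNIV. f a) + exp (- (3 / 2) * t) * f b"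
proof -
  have "(\<Sum>a\<in>UNIV. spin_transition t a b * f a)
      = (\<Sum>a\<in>UNIV. (1 - exp (- (3 / 2) * t)) / 3 * f a + (if a = b then exp (- (3 / 2) * t) * f b else 0))"
    by (intro sum.cong) (auto simp: spin_transition_eq field_simps)
  then show ?thesis by (simp add: sum.distrib sum_distrib_left)
qed

lemma sum_spin_transition: "(\<Sum>b\<in>UNIV. spin_transition t a b) = 1"
proof -
  have "spin_transition t a b = spin_transition t b a" for b
    by (simp add: spin_transition_eq)
  then show ?thesis using sum_spin_transition_mult[of t a "\<lambda>_. 1"] by (simp add: field_simps)
qed

lemma product_prob_space_spins:
  assumes "0 \<le> t"
  shows "product_prob_space (\<lambda>x. point_measure UNIV (\<lambda>b. ennreal (spin_transition t (\<sigma> x) b)))"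
proof -
  have "prob_space (point_measure UNIV (\<lambda>b. ennreal (spin_transition t a b)))" for a
    using assms by (intro prob_spaceI)
      (simp add: emeasure_point_measure_finite space_point_measure sum_ennreal
        spin_transition_nonneg sum_spin_transition)
  then show ?thesis
    by (simp add: product_prob_space_def product_prob_space_axioms_def product_sigma_finite_def
        prob_space_imp_sigma_finite)
qed

lemma space_spin_kernel: "space (spin_kernel t \<sigma>) = UNIV"
  by (simp add: spin_kernel_def space_PiM space_point_measure)

lemma sets_spin_kernel: "sets (spin_kernel t \<sigma>) = sets (\<Pi>\<^sub>M x\<in>UNIV. count_space UNIV)"
  unfolding spin_kernel_def by (rule sets_PiM_cong) (simp_all add: sets_point_measure)

lemma emeasure_spin_kernel:
  assumes "0 \<le> t" "finite J"
  shows "emeasure (spin_kernel t \<sigma>) {\<zeta>. \<forall>x\<in>J. \<zeta> x \<in> X x}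
       = (\<Prod>x\<in>J. \<Sum>b\<in>X x. ennreal (spin_transition t (\<sigma> x) b))"
proof -
  interpret product_prob_space
    "\<lambda>x. point_measure UNIV (\<lambda>b. ennreal (spin_transition t (\<sigma> x) b))" UNIV
    using assms by (intro product_prob_space_spins)
  show ?thesis
    using emeasure_PiM_Collect[of J X] assms space_spin_kernel[of t \<sigma>]
    by (simp add: spin_kernel_def sets_point_measure emeasure_point_measure_finite)
qed

text \<open>Cylinders generate the product sigma-algebra, and on a cylinder the kernel is a finite
  product of functions of single coordinates.\<close>

lemma spin_kernel_measurable:
  assumes "0 \<le> t" and M: "sets M = sets (\<Pi>\<^sub>M x\<in>UNIV. count_space UNIV)"
  shows "spin_kernel t \<in> measurable M (prob_algebra (\<Pi>\<^sub>M x\<in>UNIV. count_space UNIV))"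
proof (rule measurable_prob_algebra_generated[OF sets_PiM Int_stable_prod_algebra
      prod_algebra_sets_into_space])
  fix \<sigma> :: "'a \<Rightarrow> 3"
  interpret product_prob_space
    "\<lambda>x. point_measure UNIV (\<lambda>b. ennreal (spin_transition t (\<sigma> x) b))" UNIV
    using assms by (intro product_prob_space_spins)
  show "prob_space (spin_kernel t \<sigma>)"
    unfolding spin_kernel_def by (rule P.prob_space_axioms)
next
  fix A :: "('a \<Rightarrow> 3) set"
  assume "A \<in> prod_algebra UNIV (\<lambda>x. count_space UNIV)"
  then obtain J X where "A = prod_emb UNIV (\<lambda>x. count_space UNIV) J (PiE J X)" "finite J"
    by (rule prod_algebraE)
  then have A: "A = {\<zeta>. \<forall>x\<in>J. \<zeta> x \<in> X x}" "finite J"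
    by (auto simp: prod_emb_def PiE_def Pi_def)
  have coord: "(\<lambda>\<sigma>. \<sigma> x) \<in> measurable M (count_space UNIV)" for x
    unfolding measurable_cong_sets[OF M refl] by (rule measurable_component_singleton) simp
  have "(\<lambda>\<sigma>. \<Sum>b\<in>X x. ennreal (spin_transition t (\<sigma> x) b)) \<in> borel_measurable M" for x
    by (rule measurable_compose[OF coord]) simp
  then show "(\<lambda>\<sigma>. emeasure (spin_kernel t \<sigma>) A) \<in> borel_measurable M"
    unfolding A(1) emeasure_spin_kernel[OF assms(1) A(2)]
    by (intro borel_measurable_prod_ennreal)
qed (rule sets_spin_kernel)

lemma sets_cylinder:
  assumes M: "sets M = sets (\<Pi>\<^sub>M x\<in>UNIV. count_space (UNIV :: 3 set))" and "finite J"
  shows "{\<zeta>. \<forall>x\<in>J. \<zeta> x = \<xi> x} \<in> sets M"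
proof -
  have "{\<zeta>. \<forall>x\<in>J. \<zeta> x = \<xi> x} = prod_emb UNIV (\<lambda>x. count_space UNIV) J (PiE J (\<lambda>x. {\<xi> x}))"
    by (auto simp: prod_emb_def PiE_def Pi_def)
  also have "\<dots> \<in> sets (\<Pi>\<^sub>M x\<in>UNIV. count_space (UNIV :: 3 set))"
    using assms(2) by (intro sets_PiM_I) auto
  finally show ?thesis by (simp only: M)
qed

text \<open>Given the initial configuration the cylinder has a product probability over
  \<open>J\<close>, so the integral is a finite sum. The larger set \<open>W\<close> is there
  because the initial law is prescribed on sets that include their outer boundary.\<close>

lemma measure_time_evolved_cylinder:
  fixes M :: "('v \<Rightarrow> 3) measure"
  assumes t: "0 \<le> t" and "prob_space M"
    and M: "sets M = sets (\<Pi>\<^sub>M x\<in>UNIV. count_space UNIV)"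
    and W: "finite W" "J \<subseteq> W"
  shows "measure (time_evolved M t) {\<zeta>. \<forall>x\<in>J. \<zeta> x = \<xi> x}
       = (\<Sum>\<omega>\<in>PiE W (\<lambda>_. UNIV). measure M {\<sigma>. \<forall>x\<in>W. \<sigma> x = \<omega> x}
            * (\<Prod>x\<in>J. spin_transition t (\<omega> x) (\<xi> x)))"
proof -
  interpret prob_space M by fact
  have J: "finite J" using W by (rule rev_finite_subset)
  let ?p = "\<lambda>\<omega>. \<Prod>x\<in>J. spin_transition t (\<omega> x) (\<xi> x)"
  let ?C = "\<lambda>\<omega>. {\<sigma>. \<forall>x\<in>W. \<sigma> x = \<omega> x}"
  have p: "0 \<le> ?p \<omega>" for \<omega> :: "'v \<Rightarrow> 3" using t by (intro prod_nonneg ballI spin_transition_nonneg)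
  have fin: "finite (PiE W (\<lambda>_. UNIV :: 3 set))" using W by (intro finite_PiE) auto
  have kernel: "emeasure (spin_kernel t \<sigma>) {\<zeta>. \<forall>x\<in>J. \<zeta> x = \<xi> x} = ennreal (?p \<sigma>)" for \<sigma>
    using emeasure_spin_kernel[OF t J, of \<sigma> "\<lambda>x. {\<xi> x}"] t
    by (simp add: prod_ennreal spin_transition_nonneg)
  \<comment> \<open>Exactly one configuration on \<open>W\<close>, the restriction of
    \<open>\<sigma>\<close>, has a nonzero indicator.\<close>
  have split: "ennreal (?p \<sigma>) = (\<Sum>\<omega>\<in>PiE W (\<lambda>_. UNIV). ennreal (?p \<omega>) * indicator (?C \<omega>) \<sigma>)" for \<sigma>
  proof -
    have "(\<Sum>\<omega>\<in>PiE W (\<lambda>_. UNIV). ennreal (?p \<omega>) * indicator (?C \<omega>) \<sigma>)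
        = (\<Sum>\<omega>\<in>PiE W (\<lambda>_. UNIV). if \<omega> = restrict \<sigma> W then ennreal (?p \<omega>) else 0)"
      by (intro sum.cong)
        (auto simp: indicator_def fun_eq_iff PiE_def extensional_def restrict_def)
    also have "\<dots> = ennreal (?p (restrict \<sigma> W))" using fin by (simp add: sum.delta)
    also have "?p (restrict \<sigma> W) = ?p \<sigma>" using W by (intro prod.cong) auto
    finally show ?thesis ..
  qed
  have "emeasure (time_evolved M t) {\<zeta>. \<forall>x\<in>J. \<zeta> x = \<xi> x}
      = (\<integral>\<^sup>+\<sigma>. ennreal (?p \<sigma>) \<partial>M)"
    unfolding time_evolved_def kernel[symmetric]
    using not_empty measurable_prob_algebraD[OF spin_kernel_measurable[OF t M]] sets_cylinder[OF refl J]
    by (rule emeasure_bind)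
  also have "\<dots> = (\<integral>\<^sup>+\<sigma>. (\<Sum>\<omega>\<in>PiE W (\<lambda>_. UNIV). ennreal (?p \<omega>) * indicator (?C \<omega>) \<sigma>) \<partial>M)"
    by (intro nn_integral_cong split)
  also have "\<dots> = (\<Sum>\<omega>\<in>PiE W (\<lambda>_. UNIV). ennreal (?p \<omega>) * emeasure M (?C \<omega>))"
    using sets_cylinder[OF M W(1)]
    by (subst nn_integral_sum) (simp_all add: nn_integral_cmult_indicator)
  also have "\<dots> = ennreal (\<Sum>\<omega>\<in>PiE W (\<lambda>_. UNIV). measure M (?C \<omega>) * ?p \<omega>)"
    using p by (simp add: emeasure_eq_measure ennreal_mult[symmetric] sum_ennreal mult.commute)
  finally show ?thesis
    using p by (simp add: measure_def enn2real_ennreal sum_nonneg)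
qed

lemma sum_PiE_by_coordinate:
  assumes "finite D" "r \<in> D"
  shows "(\<Sum>\<omega>\<in>PiE D (\<lambda>_. UNIV). f \<omega>)
       = (\<Sum>a\<in>(UNIV :: 'b::finite set). \<Sum>\<omega>\<in>PiE D (\<lambda>x. if x = r then {a} else UNIV). f \<omega>)"
proof -
  have "{\<omega> \<in> PiE D (\<lambda>_. UNIV). \<omega> r = a} = PiE D (\<lambda>x. if x = r then {a} else UNIV)" for a :: 'b
    using assms(2) by (auto simp: PiE_def Pi_def)
  then show ?thesis
    using assms(1) sum.group[of "PiE D (\<lambda>_. UNIV :: 'b set)" UNIV "\<lambda>\<omega>. \<omega> r" f]
    by (simp add: finite_PiE)
qed

section \<open>The conditional law at the root as a ratio of root sums\<close>

context rooted_cayley_tree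
begin

text \<open>Site weights for the model on \<open>tball (Suc R)\<close>: the evolved root spin is not
  conditioned on, hence the weight \<open>1\<close>; the last case puts the boundary law on the
  outer sphere.\<close>

definition observation :: "real^3 \<Rightarrow> real \<Rightarrow> nat \<Rightarrow> ('v \<Rightarrow> 3) \<Rightarrow> 'v \<Rightarrow> 3 \<Rightarrow> real" where
  "observation l t R \<xi> x a =
     (if x = r then 1 else if x \<in> tball R then spin_transition t a (\<xi> x) else l $ a)"

lemma observation_pos:
  assumes "0 < t" "\<And>a. 0 < l $ a"
  shows "0 < observation l t R \<xi> x a"
  using assms by (auto simp: observation_def spin_transition_eq add_pos_nonneg)

lemma bl_weight_observation:
  "bl_weight E \<beta> l (tball R) \<omega> * (\<Prod>x\<in>tball R - {r}. spin_transition t (\<omega> x) (\<xi> x))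
     = (\<Prod>e\<in>{e \<in> E. e \<subseteq> tball (Suc R)}. edge_weight \<beta> \<omega> e)
       * (\<Prod>x\<in>tball (Suc R). observation l t R \<xi> x (\<omega> x))"
proof -
  have "(\<Prod>x\<in>tball (Suc R). observation l t R \<xi> x (\<omega> x))
      = (\<Prod>x\<in>tball R. observation l t R \<xi> x (\<omega> x))
        * (\<Prod>x\<in>outer_boundary E (tball R). observation l t R \<xi> x (\<omega> x))"
    using finite_tball finite_boundary boundary_disjoint by (simp add: prod.union_disjoint)
  moreover have "(\<Prod>x\<in>tball R. observation l t R \<xi> x (\<omega> x))
      = (\<Prod>x\<in>tball R - {r}. spin_transition t (\<omega> x) (\<xi> x))"
    using finite_tball root_in_tball
    by (subst prod.remove[of _ r]) (auto simp: observation_def intro!: prod.cong)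
  moreover have "(\<Prod>x\<in>outer_boundary E (tball R). observation l t R \<xi> x (\<omega> x))
      = (\<Prod>x\<in>outer_boundary E (tball R). l $ \<omega> x)"
    using boundary_disjoint[of R] root_in_tball[of R]
    by (intro prod.cong) (auto simp: observation_def)
  ultimately show ?thesis
    unfolding bl_weight_def edges_touching_tball by (simp add: mult_ac)
qed

lemma bl_partition_pos:
  assumes "\<And>a. 0 < l $ a"
  shows "0 < bl_partition E \<beta> l (tball R)"
proof -
  have "0 < edge_weight \<beta> \<omega> e" if "e \<in> E" for \<omega> e
    using edge_pair[OF that] by (auto simp: edge_weight_pair potts_Q_def)
  then have "0 < bl_weight E \<beta> l (tball R) \<omega>" for \<omega>
    unfolding bl_weight_def using assms by (intro mult_pos_pos prod_pos) auto
  then show ?thesis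
    unfolding bl_partition_def using finite_tball[of "Suc R"]
    by (intro sum_pos finite_PiE) (auto simp: PiE_eq_empty_iff)
qed

text \<open>Given the other evolved spins, the initial root spin has a law proportional to
  \<open>N\<close>; applying the transition matrix to this law gives the affine formula.\<close>

lemma cond_spin_prob_eq:
  fixes \<eta> :: "'v \<Rightarrow> 3" and b :: 3
  assumes \<mu>: "is_boundary_law_measure E \<beta> l \<mu>" and t: "0 < t" and l: "\<And>a. 0 < l $ a"
    and L: "L \<subseteq> tball R" "r \<in> L"
  defines "N \<equiv> root_sum \<beta> (observation l t R (\<lambda>x. if x \<in> L then \<eta> x else b)) (Suc R)"
  shows "cond_spin_prob (time_evolved \<mu> t) r j L (tball R) \<eta> b
       = (1 - exp (- (3 / 2) * t)) / 3 + exp (- (3 / 2) * t) * (N j / (\<Sum>a\<in>UNIV. N a))"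
proof -
  define \<xi> where "\<xi> x = (if x \<in> L then \<eta> x else b)" for x
  let ?W = "tball (Suc R)"
  let ?F = "observation l t R \<xi>"
  let ?w = "\<lambda>\<omega>. (\<Prod>e\<in>{e \<in> E. e \<subseteq> ?W}. edge_weight \<beta> \<omega> e) * (\<Prod>x\<in>?W. ?F x (\<omega> x))"
  define Z where "Z = bl_partition E \<beta> l (tball R)"
  have N: "N = root_sum \<beta> ?F (Suc R)" by (simp add: N_def \<xi>_def[abs_def])
  have Z: "0 < Z" unfolding Z_def using l by (rule bl_partition_pos)
  have pr: "prob_space \<mu>" and sets: "sets \<mu> = sets (\<Pi>\<^sub>M x\<in>UNIV. count_space UNIV)"
    using \<mu> by (auto simp: is_boundary_law_measure_def)
  have sp: "space \<mu> = UNIV" using sets_eq_imp_space_eq[OF sets] by (simp add: space_PiM)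
  have spt: "space (time_evolved \<mu> t) = UNIV"
  proof -
    have "sets (time_evolved \<mu> t) = sets (\<Pi>\<^sub>M x\<in>UNIV. count_space UNIV)"
      unfolding time_evolved_def using sp by (intro sets_bind) (simp_all add: sets_spin_kernel)
    from sets_eq_imp_space_eq[OF this] show ?thesis by (simp add: space_PiM)
  qed
  have \<mu>W: "measure \<mu> {\<sigma>. \<forall>x\<in>?W. \<sigma> x = \<omega> x} = bl_weight E \<beta> l (tball R) \<omega> / Z" for \<omega>
  proof -
    have "tball R \<noteq> {}" using root_in_tball by blast
    with \<mu> finite_tball connected_tball
    have "\<P>(\<sigma> in \<mu>. \<forall>x\<in>tball R \<union> outer_boundary E (tball R). \<sigma> x = \<omega> x)
        = bl_weight E \<beta> l (tball R) \<omega> / bl_partition E \<beta> l (tball R)"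
      unfolding is_boundary_law_measure_def by simp
    then show ?thesis unfolding Z_def by (simp add: sp)
  qed
  have evolved: "measure (time_evolved \<mu> t) {\<zeta>. \<forall>x\<in>J. \<zeta> x = \<xi>' x}
      = (\<Sum>\<omega>\<in>PiE ?W (\<lambda>_. UNIV). bl_weight E \<beta> l (tball R) \<omega>
          * (\<Prod>x\<in>J. spin_transition t (\<omega> x) (\<xi>' x))) / Z" if "J \<subseteq> tball R" for J \<xi>'
  proof -
    have "J \<subseteq> ?W" using that by auto
    from measure_time_evolved_cylinder[OF less_imp_le[OF t] pr sets finite_tball this]
    show ?thesis unfolding \<mu>W sum_divide_distrib by (simp only: times_divide_eq_left)
  qed
  have den: "measure (time_evolved \<mu> t) {\<zeta>. \<forall>x\<in>tball R - {r}. \<zeta> x = \<xi> x}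
      = (\<Sum>a\<in>UNIV. N a) / Z"
    unfolding evolved[OF Diff_subset] bl_weight_observation N root_sum_def
    by (simp only: sum_PiE_by_coordinate[OF finite_tball root_in_tball])
  have num: "measure (time_evolved \<mu> t) {\<zeta>. \<zeta> r = j \<and> (\<forall>x\<in>tball R - {r}. \<zeta> x = \<xi> x)}
      = (\<Sum>a\<in>UNIV. spin_transition t a j * N a) / Z"
  proof -
    \<comment> \<open>With the target at the root overwritten by \<open>j\<close>, the joint event
      is again a cylinder, now over the whole ball.\<close>
    have ev: "{\<zeta>. \<zeta> r = j \<and> (\<forall>x\<in>tball R - {r}. \<zeta> x = \<xi> x)} = {\<zeta>. \<forall>x\<in>tball R. \<zeta> x = (\<xi>(r := j)) x}"
      using root_in_tball[of R] by auto
    have pr': "(\<Prod>x\<in>tball R. spin_transition t (\<omega> x) ((\<xi>(r := j)) x))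
        = spin_transition t (\<omega> r) j * (\<Prod>x\<in>tball R - {r}. spin_transition t (\<omega> x) (\<xi> x))" for \<omega>
      using finite_tball root_in_tball by (subst prod.remove[of _ r]) (auto intro!: prod.cong)
    have w: "bl_weight E \<beta> l (tball R) \<omega> * (\<Prod>x\<in>tball R. spin_transition t (\<omega> x) ((\<xi>(r := j)) x))
        = spin_transition t (\<omega> r) j * ?w \<omega>" for \<omega>
      unfolding pr' bl_weight_observation[symmetric] by (simp only: mult_ac)
    have "measure (time_evolved \<mu> t) {\<zeta>. \<forall>x\<in>tball R. \<zeta> x = (\<xi>(r := j)) x}
        = (\<Sum>a\<in>UNIV. \<Sum>\<omega>\<in>PiE ?W (\<lambda>x. if x = r then {a} else UNIV).
            spin_transition t (\<omega> r) j * ?w \<omega>) / Z"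
      unfolding evolved[OF order_refl] w
      by (simp only: sum_PiE_by_coordinate[OF finite_tball root_in_tball])
    also have "\<dots> = (\<Sum>a\<in>UNIV. spin_transition t a j * N a) / Z"
    proof -
      have root: "\<omega> r = a" if "\<omega> \<in> PiE ?W (\<lambda>x. if x = r then {a} else UNIV)" for \<omega> a
        using PiE_mem[OF that root_in_tball] by simp
      show ?thesis
        unfolding N root_sum_def sum_distrib_left
      proof (intro arg_cong[of _ _ "\<lambda>x. x / Z"] sum.cong refl, goal_cases)
        case (1 a \<omega>)
        show ?case by (simp only: root[OF 1(2)])
      qed
    qed
    finally show ?thesis by (simp only: ev)
  qed
  have "(\<forall>x\<in>L - {r}. \<zeta> x = \<eta> x) \<and> (\<forall>x\<in>tball R - L. \<zeta> x = b)
      \<longleftrightarrow> (\<forall>x\<in>tball R - {r}. \<zeta> x = \<xi> x)" for \<zeta>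
  proof -
    \<comment> \<open>\<open>r \<in> L\<close> keeps the root out of \<open>tball R - L\<close>, so
      the two conditions together fix exactly the punctured ball.\<close>
    have "tball R - {r} = (L - {r}) \<union> (tball R - L)" using L by blast
    then show ?thesis by (simp add: \<xi>_def ball_Un)
  qed
  then have "cond_spin_prob (time_evolved \<mu> t) r j L (tball R) \<eta> b
      = measure (time_evolved \<mu> t) {\<zeta>. \<zeta> r = j \<and> (\<forall>x\<in>tball R - {r}. \<zeta> x = \<xi> x)}
        / measure (time_evolved \<mu> t) {\<zeta>. \<forall>x\<in>tball R - {r}. \<zeta> x = \<xi> x}"
    by (simp only: cond_spin_prob_def cond_prob_def spt UNIV_I simp_thms)
  then have "cond_spin_prob (time_evolved \<mu> t) r j L (tball R) \<eta> b
      = (\<Sum>a\<in>UNIV. spin_transition t a j * N a) / (\<Sum>a\<in>UNIV. N a)"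
    unfolding num den using Z by simp
  moreover have "0 < (\<Sum>a\<in>UNIV. N a)"
    unfolding N by (intro sum_pos root_sum_pos observation_pos t l) simp_all
  ultimately show ?thesis
    unfolding sum_spin_transition_mult by (simp add: add_divide_distrib)
qed

end

subsection \<open>Two distinct conditional laws at the root\<close>

text \<open>The hypothesis bounds the ratio of the largest to the smallest transition probability by
  \<open>\<kappa>\<close>, so no observed spin \<open>b\<close> favours another spin over
  \<open>j\<close> by more than that.\<close>

lemma dominant_spin_transition:
  assumes "0 < t" "1 + 2 * exp (- (3 / 2) * t) \<le> \<kappa> * (1 - exp (- (3 / 2) * t))" "0 < \<kappa>"
  shows "dominant (1 / \<kappa>) j (\<lambda>a. spin_transition t a b)"
proof -
  have "spin_transition t a b \<le> (1 + 2 * exp (- (3 / 2) * t)) / 3" for a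
    using exp_gt_zero[of "- (3 / 2) * t"] by (simp add: spin_transition_eq)
  moreover have "(1 - exp (- (3 / 2) * t)) / 3 \<le> spin_transition t j b"
    using exp_gt_zero[of "- (3 / 2) * t"] by (simp add: spin_transition_eq)
  then have "\<kappa> * ((1 - exp (- (3 / 2) * t)) / 3) \<le> \<kappa> * spin_transition t j b"
    using assms(3) by (intro mult_left_mono) auto
  ultimately have "spin_transition t a b \<le> \<kappa> * spin_transition t j b" for a
    using assms(2) by (smt (verit) divide_right_mono times_divide_eq_right)
  then show ?thesis using assms(3) by (simp add: dominant_def field_simps)
qed

text \<open>\<open>l_minus\<close> has equal entries at \<open>j\<close> and \<open>k\<close>, and
  \<open>x_minus \<theta> \<le> 1\<close> keeps the entry at \<open>i\<close> from exceeding them;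
  \<open>l_free\<close> is constant.\<close>

lemma boundary_law_positive_dominant:
  assumes \<theta>: "4 < \<theta>" and "distinct [i, j, k]" and l: "l = l_minus \<theta> i \<or> l = l_free"
  shows "0 < l $ a" "dominant 1 j (\<lambda>a. l $ a)" "dominant 1 k (\<lambda>a. l $ a)"
proof -
  define s where "s = sqrt ((\<theta> - 1)\<^sup>2 - 8)"
  \<comment> \<open>The right side exceeds the left by \<open>4 * \<theta> - 16\<close>; the
    resulting lower bound on \<open>s\<close> is what yields
    \<open>x_minus \<theta> \<le> 1\<close>.\<close>
  have "(\<theta> - 3)\<^sup>2 \<le> (\<theta> - 1)\<^sup>2 - 8" using \<theta> by (simp add: power2_eq_square algebra_simps)
  then have "\<theta> - 3 \<le> s" unfolding s_def by (rule real_le_rsqrt)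
  moreover have "s < \<theta> - 1"
  proof -
    have "s < sqrt ((\<theta> - 1)\<^sup>2)" unfolding s_def by (subst real_sqrt_less_iff) simp
    then show ?thesis using \<theta> by simp
  qed
  ultimately have "0 < (\<theta> - 1 - s) / 2" "(\<theta> - 1 - s) / 2 \<le> 1" by auto
  then have x: "0 < x_minus \<theta>" "x_minus \<theta> \<le> 1"
    unfolding x_minus_def s_def[symmetric] by (auto simp: power_le_one)
  show "0 < l $ a" "dominant 1 j (\<lambda>a. l $ a)" "dominant 1 k (\<lambda>a. l $ a)"
    using l assms(2) x
    by (auto simp: l_minus_def l_free_def dominant_def add_pos_pos divide_right_mono)
qed

context rooted_cayley_tree
begin

text \<open>Inside \<open>tball n\<close> the observed spins are arbitrary but weak by
  \<open>small\<close>, on the annulus they all equal \<open>j\<close> and favour it by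
  \<open>h\<close>, and the outer sphere carries \<open>l\<close>, which already has dominance
  \<open>1\<close>.\<close>

lemma root_sum_observation_dominant:
  assumes \<beta>: "4 < exp \<beta>" and t: "0 < t"
    and small: "1 + 2 * exp (- (3 / 2) * t)
      \<le> (gain (exp \<beta>) 4)\<^sup>2 / 4 * (1 - exp (- (3 / 2) * t))"
    and l: "\<And>a. 0 < l $ a" "dominant 1 j (\<lambda>a. l $ a)"
    and h: "h = (1 + 2 * exp (- (3 / 2) * t)) / (1 - exp (- (3 / 2) * t))" "4 \<le> h ^ m"
    and \<xi>: "\<And>x. x \<notin> tball n \<Longrightarrow> \<xi> x = j"
  shows "dominant 4 j (root_sum \<beta> (observation l t (n + m) \<xi>) (Suc (n + m)))"
proof -
  let ?\<phi> = "observation l t (n + m) \<xi>" and ?\<kappa> = "(gain (exp \<beta>) 4)\<^sup>2 / 4"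
  have \<kappa>: "1 < ?\<kappa>" using gain_4_gt[OF \<beta>] by simp
  have e: "0 < exp (- (3 / 2) * t)" "exp (- (3 / 2) * t) < 1" using t by auto
  have "1 \<le> h" using e unfolding h by (simp add: field_simps)
  have weak: "dominant (4 / (gain (exp \<beta>) 4)\<^sup>2) j (?\<phi> y)" for y
  proof -
    have "dominant (1 / ?\<kappa>) j (\<lambda>a. l $ a)"
      using l(2) by (rule dominant_mono) (use \<kappa> l(1) in \<open>auto simp: divide_le_eq less_imp_le\<close>)
    moreover have "dominant (1 / ?\<kappa>) j (\<lambda>a. 1)"
      using \<kappa> unfolding dominant_def by (simp add: divide_le_eq)
    moreover have "dominant (1 / ?\<kappa>) j (\<lambda>a. spin_transition t a (\<xi> y))"
      using t small \<kappa> by (intro dominant_spin_transition) auto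
    ultimately have "dominant (1 / ?\<kappa>) j (?\<phi> y)"
      by (cases "y = r"; cases "y \<in> tball (n + m)") (simp_all add: observation_def[abs_def])
    then show ?thesis by simp
  qed
  \<comment> \<open>The annulus has radii \<open>Suc n\<close> to \<open>n + m\<close>, so it starts
    one step beyond \<open>n\<close>; the sphere of radius \<open>Suc n + m\<close> is the one that
    carries \<open>l\<close>.\<close>
  have strong: "dominant h j (?\<phi> y)" if "Suc n \<le> q" "q < Suc n + m" "y \<in> shell q" for q y
  proof -
    have "y \<in> tball (n + m)" using that shell_subset[of q] tball_mono[of q "n + m"] by auto
    moreover have "y \<notin> tball n" using that shell_disjoint[of n q] by auto
    moreover from this have "y \<noteq> r" using root_in_tball by auto
    ultimately show ?thesis
      using e \<xi> by (auto simp: dominant_def observation_def spin_transition_eq h)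
  qed
  have outer: "dominant 1 j (?\<phi> y)" if "y \<in> shell (Suc n + m)" for y
  proof -
    have "y \<notin> tball (n + m)" using that boundary_disjoint[of "n + m"] by auto
    moreover from this have "y \<noteq> r" using root_in_tball by auto
    ultimately show ?thesis using l(2) by (simp add: observation_def[abs_def])
  qed
  have "dominant 4 j (root_sum \<beta> ?\<phi> (Suc n + m))"
    using h(2) by (intro root_sum_dominant[OF \<beta> \<open>1 \<le> h\<close> observation_pos[OF t l(1)] weak strong outer]) simp_all
  then show ?thesis by simp
qed

end

text \<open>The extremal weights are \<open>4, 1, 1\<close> for the first bound and
  \<open>4, 1, 0\<close> for the second.\<close>

lemma dominant_fraction:
  assumes "\<And>a. 0 < N a" "dominant 4 j N"
  shows "2 / 3 \<le> N j / (\<Sum>a\<in>UNIV. N a)" and "a \<noteq> j \<Longrightarrow> N a / (\<Sum>a\<in>UNIV. N a) \<le> 1 / 5"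
proof -
  have S: "0 < (\<Sum>a\<in>UNIV. N a)" using assms(1) by (intro sum_pos) auto
  have "(2::3) \<noteq> 1" by simp
  then obtain a :: 3 where "a \<noteq> j" by metis
  then obtain b where b: "b \<noteq> a" "b \<noteq> j" "UNIV = {j, a, b}" by (rule third_spin)
  have "4 * N a \<le> N j" "4 * N b \<le> N j" using assms(2) b \<open>a \<noteq> j\<close> by (auto simp: dominant_def)
  then have "2 * (\<Sum>a\<in>UNIV. N a) \<le> 3 * N j"
    unfolding sum_spins[OF \<open>a \<noteq> j\<close> b] by simp
  then show "2 / 3 \<le> N j / (\<Sum>a\<in>UNIV. N a)" using S by (simp add: field_simps)
  show "N a / (\<Sum>a\<in>UNIV. N a) \<le> 1 / 5" if a: "a \<noteq> j" for a
  proof -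
    obtain b where b: "b \<noteq> a" "b \<noteq> j" "UNIV = {j, a, b}" using a by (rule third_spin)
    have "4 * N a \<le> N j" using assms(2) a by (auto simp: dominant_def)
    then have "5 * N a \<le> (\<Sum>a\<in>UNIV. N a)"
      unfolding sum_spins[OF a b] using assms(1)[of b] by linarith
    then show ?thesis using S by (simp add: field_simps)
  qed
qed

theorem theorem2:
  fixes E :: "'v set set" and r :: 'v and \<beta> :: real and i j k :: 3
    and l :: "real^3" and \<mu> :: "('v \<Rightarrow> 3) measure"
  assumes "cayley_tree E"
    and "\<beta> > 0" and "exp \<beta> > 4"
    and "distinct [i, j, k]"
    and "l = l_minus (exp \<beta>) i \<or> l = l_free"
    and "is_boundary_law_measure E \<beta> l \<mu>"
  shows "\<exists>t\<^sub>B\<ge>0. \<forall>t\<ge>t\<^sub>B. \<exists>\<epsilon>>0. \<forall>\<Lambda>. cofinal_seq \<Lambda> \<longrightarrow>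
           (\<exists>\<Delta>. (\<forall>n. finite (\<Delta> n) \<and> \<Lambda> n \<subseteq> \<Delta> n) \<and>
             (\<forall>\<eta>. liminf (\<lambda>n. ereal
                 \<bar>cond_spin_prob (time_evolved \<mu> t) r j (\<Lambda> n) (\<Delta> n) \<eta> j
                   - cond_spin_prob (time_evolved \<mu> t) r j (\<Lambda> n) (\<Delta> n) \<eta> k\<bar>) \<ge> ereal \<epsilon>))"
proof -
  interpret rooted_cayley_tree E r using assms(1) by unfold_locales
  note \<beta> = assms(3)
  note l = boundary_law_positive_dominant[OF assms(3-5)]
  have "j \<noteq> k" using assms(4) by simp
  define \<kappa> where "\<kappa> = (gain (exp \<beta>) 4)\<^sup>2 / 4"
  have \<kappa>: "1 < \<kappa>" using gain_4_gt[OF \<beta>] by (simp add: \<kappa>_def)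
  \<comment> \<open>The solution of \<open>1 + 2 * e = \<kappa> * (1 - e)\<close>; the threshold
    time below is the one at which \<open>exp (- (3 / 2) * t)\<close> has dropped to this
    value.\<close>
  define e\<^sub>0 where "e\<^sub>0 = (\<kappa> - 1) / (\<kappa> + 2)"
  have e\<^sub>0: "0 < e\<^sub>0" "e\<^sub>0 < 1" using \<kappa> by (auto simp: e\<^sub>0_def)
  show ?thesis
  proof (rule exI[of _ "- (2 / 3) * ln e\<^sub>0"], intro conjI allI impI)
    show "0 \<le> - (2 / 3) * ln e\<^sub>0" using e\<^sub>0 by simp
  next
    fix t assume "- (2 / 3) * ln e\<^sub>0 \<le> t"
    define e where "e = exp (- (3 / 2) * t)"
    have "- (3 / 2) * t \<le> ln e\<^sub>0" using \<open>- (2 / 3) * ln e\<^sub>0 \<le> t\<close> by simp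
    then have "e \<le> exp (ln e\<^sub>0)" unfolding e_def by (subst exp_le_cancel_iff)
    moreover have "0 < e" by (simp add: e_def)
    ultimately have e: "0 < e" "e \<le> e\<^sub>0" "e < 1" using e\<^sub>0 by auto
    have t: "0 < t" using e(3) by (simp add: e_def)
    have small: "1 + 2 * e \<le> \<kappa> * (1 - e)"
      using e(2) \<kappa> unfolding e\<^sub>0_def by (simp add: field_simps)
    define h where "h = (1 + 2 * e) / (1 - e)"
    have "1 < h" using e by (simp add: h_def)
    \<comment> \<open>The thickness of the annulus depends on \<open>t\<close>, but not on
      \<open>\<Lambda>\<close>, \<open>n\<close> or \<open>\<eta>\<close>.\<close>
    then obtain m where m: "4 < h ^ m" using real_arch_pow by blast
    show "\<exists>\<epsilon>>0. \<forall>\<Lambda>. cofinal_seq \<Lambda> \<longrightarrow>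
           (\<exists>\<Delta>. (\<forall>n. finite (\<Delta> n) \<and> \<Lambda> n \<subseteq> \<Delta> n) \<and>
             (\<forall>\<eta>. liminf (\<lambda>n. ereal
                 \<bar>cond_spin_prob (time_evolved \<mu> t) r j (\<Lambda> n) (\<Delta> n) \<eta> j
                   - cond_spin_prob (time_evolved \<mu> t) r j (\<Lambda> n) (\<Delta> n) \<eta> k\<bar>) \<ge> ereal \<epsilon>))"
    \<comment> \<open>\<open>7 / 15\<close> is \<open>2 / 3 - 1 / 5\<close>, the gap between the two
      laws of the initial root spin; evolving the root contracts it by \<open>e\<close>.\<close>
    proof (rule exI[of _ "e * (7 / 15)"], intro conjI allI impI)
      show "0 < e * (7 / 15)" using e by simp
    next
      fix \<Lambda> :: "nat \<Rightarrow> 'v set"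
      assume \<Lambda>: "cofinal_seq \<Lambda>"
      then have "\<forall>n. \<exists>R. \<Lambda> n \<subseteq> tball R"
        using finite_subset_tball by (auto simp: cofinal_seq_def)
      then obtain \<rho> where \<rho>: "\<And>n. \<Lambda> n \<subseteq> tball (\<rho> n)" by metis
      \<comment> \<open>Everything up to radius \<open>\<rho> n\<close> is treated as arbitrary,
        including the part outside \<open>\<Lambda> n\<close>; the next \<open>m\<close> spheres
        form the annulus.\<close>
      let ?\<Delta> = "\<lambda>n. tball (\<rho> n + m)"
      have sub: "\<Lambda> n \<subseteq> ?\<Delta> n" for n
        using \<rho>[of n] tball_mono[of "\<rho> n" "\<rho> n + m"] by auto
      have gap: "e * (7 / 15) \<le> \<bar>cond_spin_prob (time_evolved \<mu> t) r j (\<Lambda> n) (?\<Delta> n) \<eta> j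
                   - cond_spin_prob (time_evolved \<mu> t) r j (\<Lambda> n) (?\<Delta> n) \<eta> k\<bar>"
        if r: "r \<in> \<Lambda> n" for n \<eta>
      proof -
        define N where "N b = root_sum \<beta> (observation l t (\<rho> n + m)
            (\<lambda>x. if x \<in> \<Lambda> n then \<eta> x else b)) (Suc (\<rho> n + m))" for b
        have cond: "cond_spin_prob (time_evolved \<mu> t) r j (\<Lambda> n) (?\<Delta> n) \<eta> b
            = (1 - e) / 3 + e * (N b j / (\<Sum>a\<in>UNIV. N b a))" for b
          unfolding e_def N_def by (rule cond_spin_prob_eq[OF assms(6) t l(1) sub r])
        have pos: "0 < N b a" for b a
          unfolding N_def by (intro root_sum_pos observation_pos t l(1))
        have dom: "dominant 4 b (N b)" if "dominant 1 b (\<lambda>a. l $ a)" for b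
          unfolding N_def using \<rho>[of n] m
          by (intro root_sum_observation_dominant[OF \<beta> t small[unfolded e_def \<kappa>_def] l(1) that
                h_def[unfolded e_def]]) auto
        have "2 / 3 \<le> N j j / (\<Sum>a\<in>UNIV. N j a)"
          by (rule dominant_fraction(1)[OF pos dom[OF l(2)]])
        moreover have "N k j / (\<Sum>a\<in>UNIV. N k a) \<le> 1 / 5"
          by (rule dominant_fraction(2)[OF pos dom[OF l(3)] \<open>j \<noteq> k\<close>])
        ultimately have "7 / 15
            \<le> N j j / (\<Sum>a\<in>UNIV. N j a) - N k j / (\<Sum>a\<in>UNIV. N k a)"
          by linarith
        then have "e * (7 / 15)
            \<le> e * (N j j / (\<Sum>a\<in>UNIV. N j a) - N k j / (\<Sum>a\<in>UNIV. N k a))"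
          using e by (intro mult_left_mono) simp_all
        also have "\<dots> = cond_spin_prob (time_evolved \<mu> t) r j (\<Lambda> n) (?\<Delta> n) \<eta> j
            - cond_spin_prob (time_evolved \<mu> t) r j (\<Lambda> n) (?\<Delta> n) \<eta> k"
          unfolding cond right_diff_distrib by linarith
        finally show ?thesis by linarith
      qed
      \<comment> \<open>The root lies in \<open>\<Lambda> n\<close> only from some index on, which
        suffices for the limit inferior.\<close>
      have "r \<in> (\<Union>n. \<Lambda> n)" using \<Lambda> by (simp add: cofinal_seq_def)
      then obtain n\<^sub>0 where "r \<in> \<Lambda> n\<^sub>0" by blast
      then have "\<forall>n\<ge>n\<^sub>0. r \<in> \<Lambda> n" using \<Lambda> by (auto simp: cofinal_seq_def dest: incseqD)
      then have "\<forall>\<^sub>F n in sequentially. r \<in> \<Lambda> n"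
        unfolding eventually_sequentially by blast
      then have "ereal (e * (7 / 15)) \<le> liminf (\<lambda>n. ereal
            \<bar>cond_spin_prob (time_evolved \<mu> t) r j (\<Lambda> n) (?\<Delta> n) \<eta> j
              - cond_spin_prob (time_evolved \<mu> t) r j (\<Lambda> n) (?\<Delta> n) \<eta> k\<bar>)" for \<eta>
        by (intro Liminf_bounded, elim eventually_mono) (simp only: ereal_less_eq gap)
      then show "\<exists>\<Delta>. (\<forall>n. finite (\<Delta> n) \<and> \<Lambda> n \<subseteq> \<Delta> n) \<and>
             (\<forall>\<eta>. liminf (\<lambda>n. ereal
                 \<bar>cond_spin_prob (time_evolved \<mu> t) r j (\<Lambda> n) (\<Delta> n) \<eta> j
                   - cond_spin_prob (time_evolved \<mu> t) r j (\<Lambda> n) (\<Delta> n) \<eta> k\<bar>) \<ge> ereal (e * (7 / 15)))"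
        using finite_tball sub by (intro exI[of _ ?\<Delta>]) auto
    qed
  qed
qed

end
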